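(* Each of the following four situations occurs: there exist subfields $K \subseteq L \subseteq \overline{\mathbb{Q}}$ such that $K/\mathbb{Q}$ is an infinite extension, $K$ does not satisfy the Bogomolov property (B), and (a) $L/K$ is finite and Bogomolov; respectively (b) $L/K$ is finite and not Bogomolov; respectively (c) $L/K$ is infinite and Bogomolov; respectively (d) $L/K$ is infinite and not Bogomolov.
   Context: All fields are subfields of a fixed algebraic closure $\overline{\mathbb{Q}}$ of $\mathbb{Q}$. $h$ denotes the absolute logarithmic Weil height on $\overline{\mathbb{Q}}$. A field $K\subseteq\overline{\mathbb{Q}}$ satisfies the Bogomolov property (B) if there exists $\varepsilon>0$ such that no $\alpha\in K^\times$ satisfies $0<h(\alpha)<\varepsilon$. For fields $\mathbb{Q}\subseteq K\subseteq L\subseteq\overline{\mathbb{Q}}$, the extension $L/K$ is called Bogomolov (satisfies the relative Bogomolov property) if there exists $\varepsilon>0$ such that $\{\alpha\in L^\times : 0<h(\alpha)<\varepsilon\}\subseteq K$. *)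

theory Defs
  imports
    "HOL-Algebra.Embedded_Algebras"
    "HOL-Algebra.Algebraic_Closure_Type"
    "Berlekamp_Zassenhaus.Mahler_Measure"
begin

text \<open>
  The fixed algebraic closure of the rationals is realised inside the complex numbers.
  Subfields and dimensions are those of \<^theory>\<open>HOL-Algebra.Embedded_Algebras\<close>, taken in the
  field of complex numbers viewed as a ring record.
\<close>

definition Qbar :: "complex set" where
  "Qbar = {x. Polynomial.algebraic x}"

abbreviation complex_field :: "complex ring" where
  "complex_field \<equiv> ring_of_type_algebra"

abbreviation is_field :: "complex set \<Rightarrow> bool" where
  "is_field K \<equiv> subfield K complex_field"

abbreviation finite_ext :: "complex set \<Rightarrow> complex set \<Rightarrow> bool" where
  "finite_ext L K \<equiv> ring.finite_dimension complex_field K L"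

text \<open>
  An irreducible element of \<open>\<int>[X]\<close> with a complex root is automatically primitive, so this is the
  usual minimal polynomial over the integers: coprime coefficients, positive leading coefficient.
\<close>

definition is_min_int_poly :: "int poly \<Rightarrow> complex \<Rightarrow> bool" where
  "is_min_int_poly p x \<longleftrightarrow>
     comm_semiring_1_class.irreducible p \<and> Polynomial.lead_coeff p > 0 \<and>
     poly (map_poly of_int p) x = 0"

definition min_int_poly :: "complex \<Rightarrow> int poly" where
  "min_int_poly x = (THE p. is_min_int_poly p x)"

abbreviation (input) int_root :: "int poly \<Rightarrow> complex \<Rightarrow> bool" where
  "int_root f x \<equiv> f \<noteq> 0 \<and> poly (map_poly of_int f) x = 0"

lemma degree_pos_of_int_root:
  assumes "int_root f x"
  shows "Polynomial.degree f > 0"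
proof (rule ccontr)
  assume "\<not> Polynomial.degree f > 0"
  then obtain c where "f = [:c:]" by (metis degree_eq_zeroE gr0I)
  with assms show False by (simp add: of_int_hom.map_poly_pCons_hom)
qed

lemma irreducible_int_root_dvd:
  assumes p: "comm_semiring_1_class.irreducible (p :: int poly)" "int_root p x"
    and p': "comm_semiring_1_class.irreducible (p' :: int poly)" "int_root p' x"
  shows "p' dvd p"
proof -
  obtain r where r: "int_root r x"
    and r_min: "\<And>f. int_root f x \<Longrightarrow> Polynomial.degree r \<le> Polynomial.degree f"
    using ex_has_least_nat[of "\<lambda>f. int_root f x" p Polynomial.degree] p(2) by auto
  have multiple: "\<exists>a q. a \<noteq> 0 \<and> Polynomial.smult a f = r * q" if f: "int_root f x" for f
  proof -
    from pseudo_mod[of r f] r obtain a q where aq: "a \<noteq> 0"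
      "Polynomial.smult a f = r * q + pseudo_mod f r"
      "pseudo_mod f r = 0 \<or> Polynomial.degree (pseudo_mod f r) < Polynomial.degree r"
      by blast
    from aq(2) have eq: "pseudo_mod f r = Polynomial.smult a f - r * q" by simp
    have "poly (map_poly of_int (pseudo_mod f r)) x = 0"
      unfolding eq using f r
      by (simp add: of_int_poly_hom.hom_minus of_int_poly_hom.hom_mult of_int_hom.map_poly_hom_smult)
    with aq(3) r_min[of "pseudo_mod f r"] have "pseudo_mod f r = 0" by fastforce
    with aq show ?thesis by auto
  qed
  have dvd_r: "\<exists>b. b \<noteq> 0 \<and> r = Polynomial.smult b f"
    if f: "comm_semiring_1_class.irreducible f" "int_root f x" for f
  proof -
    obtain a q where aq: "a \<noteq> 0" "Polynomial.smult a f = r * q" using multiple f(2) by blast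
    have "f dvd r * q" by (metis aq(2) dvd_refl dvd_smult)
    moreover have "\<not> f dvd q"
    proof
      assume "f dvd q"
      then obtain t where "q = f * t" ..
      with aq(2) have "f * [:a:] = f * (r * t)" by (simp add: ac_simps)
      hence "[:a:] = r * t" using f(2) mult_left_cancel by blast
      moreover from this aq(1) have "r \<noteq> 0" "t \<noteq> 0" by auto
      ultimately have "Polynomial.degree r = 0"
        by (metis add_is_0 degree_mult_eq degree_pCons_0)
      with degree_pos_of_int_root[OF r] show False by simp
    qed
    ultimately have "f dvd r"
      using prime_elem_dvd_mult_iff[OF irreducible_imp_prime_elem[OF f(1)], of r q] by simp
    then obtain s where s: "r = f * s" ..
    with aq(2) have "f * [:a:] = f * (s * q)" by (simp add: ac_simps)
    hence "[:a:] = s * q" using f(2) mult_left_cancel by blast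
    moreover from this aq(1) have "s \<noteq> 0" "q \<noteq> 0" by auto
    ultimately have "Polynomial.degree s = 0"
      by (metis add_is_0 degree_mult_eq degree_pCons_0)
    then obtain b where "s = [:b:]" by (rule degree_eq_zeroE)
    with s \<open>s \<noteq> 0\<close> show ?thesis by (intro exI[of _ b]) auto
  qed
  obtain b where b: "b \<noteq> 0" "r = Polynomial.smult b p" using dvd_r p by blast
  obtain b' where b': "b' \<noteq> 0" "r = Polynomial.smult b' p'" using dvd_r p' by blast
  have "p' dvd [:b:] * p"
    using dvd_smult[OF dvd_refl, of p' b'] b(2) b'(2) by simp
  moreover have "\<not> p' dvd [:b:]"
  proof
    assume "p' dvd [:b:]"
    with b(1) have "Polynomial.degree p' \<le> Polynomial.degree [:b:]"
      by (intro dvd_imp_degree_le) auto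
    with degree_pos_of_int_root[OF p'(2)] show False by simp
  qed
  ultimately show ?thesis
    using prime_elem_dvd_mult_iff[OF irreducible_imp_prime_elem[OF p'(1)], of "[:b:]" p] by simp
qed

lemma ex1_min_int_poly:
  assumes "x \<in> Qbar"
  shows "\<exists>!p. is_min_int_poly p x"
proof (rule ex_ex1I)
  obtain f where f: "f \<noteq> 0" "poly (map_poly of_int f) x = 0"
    using assms algebraicE'[of x] unfolding Qbar_def by blast
  have "poly (map_poly of_int (prod_mset (prime_factorization f))) x = 0"
    using prod_mset_prime_factorization_weak[OF f(1)] f(2)
    by (metis dvd_def dvd_refl normalize_dvd_iff of_int_poly_hom.hom_mult mult_zero_left poly_mult
        dvd_normalize_iff)
  moreover have "poly (map_poly of_int (prod_mset M)) x = 0 \<Longrightarrow>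
      \<exists>p \<in># M. poly (map_poly of_int p) x = 0" for M :: "int poly multiset"
    by (induction M) (auto simp: of_int_poly_hom.hom_mult)
  ultimately have "\<exists>p \<in># prime_factorization f. poly (map_poly of_int p) x = 0" by blast
  then obtain p where p: "p \<in># prime_factorization f" "poly (map_poly of_int p) x = 0" by blast
  hence "prime p" by auto
  hence "comm_semiring_1_class.irreducible p" "normalize p = p" "p \<noteq> 0"
    by (auto simp: prime_def prime_elem_imp_irreducible normalize_prime)
  moreover have "Polynomial.lead_coeff p > 0"
  proof -
    have "unit_factor p = 1"
      using unit_factor_normalize[of p] \<open>normalize p = p\<close> \<open>p \<noteq> 0\<close> by simp
    hence "poly [:sgn (Polynomial.lead_coeff p):] 0 = poly 1 0"
      by (simp only: unit_factor_poly_def unit_factor_int_def)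
    hence "sgn (Polynomial.lead_coeff p) = 1" by simp
    thus ?thesis by (simp add: sgn_1_pos)
  qed
  ultimately show "\<exists>p. is_min_int_poly p x"
    using p(2) unfolding is_min_int_poly_def by blast
next
  fix p q assume p: "is_min_int_poly p x" and q: "is_min_int_poly q x"
  hence "p dvd q" "q dvd p"
    by (auto simp: is_min_int_poly_def intro!: irreducible_int_root_dvd[of _ x])
  moreover from p q have "normalize p = p" "normalize q = q"
    by (auto simp: is_min_int_poly_def normalize_poly_def)
  ultimately show "p = q" by (rule associated_eqI)
qed

lemma is_min_int_poly_min_int_poly:
  "x \<in> Qbar \<Longrightarrow> is_min_int_poly (min_int_poly x) x"
  unfolding min_int_poly_def by (rule theI') (rule ex1_min_int_poly)

text \<open>
  The absolute logarithmic Weil height is \<open>h(x) = (1/d) log M(f)\<close>, where \<open>f\<close> is the minimal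
  polynomial of \<open>x\<close> over the integers, \<open>d\<close> its degree and \<open>M(f)\<close> its Mahler measure, i.e. the
  absolute value of the leading coefficient times the product of \<open>max 1 \<bar>z\<bar>\<close> over all complex
  roots \<open>z\<close>. Outside \<^const>\<open>Qbar\<close> the value is meaningless.
\<close>

definition weil_height :: "complex \<Rightarrow> real" where
  "weil_height x = ln (mahler_measure (min_int_poly x)) / real (Polynomial.degree (min_int_poly x))"

definition bogomolov :: "complex set \<Rightarrow> bool" where
  "bogomolov K \<longleftrightarrow> (\<exists>\<epsilon>>0. \<not> (\<exists>\<alpha>\<in>K - {0}. 0 < weil_height \<alpha> \<and> weil_height \<alpha> < \<epsilon>))"

definition bogomolov_ext :: "complex set \<Rightarrow> complex set \<Rightarrow> bool" where
  "bogomolov_ext L K \<longleftrightarrow>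
     (\<exists>\<epsilon>>0. {\<alpha> \<in> L - {0}. 0 < weil_height \<alpha> \<and> weil_height \<alpha> < \<epsilon>} \<subseteq> K)"

end

theory Submission
  imports Defs
begin

text \<open>
  Let \<open>K\<close> be generated by all \<open>3\<^sup>n\<close>-th roots of \<open>2\<close>; it contains elements of height \<open>ln 2 / 3\<^sup>n\<close>.
  Adjoining to \<open>K\<close> the square roots of all primes \<open>p \<ge> 5\<close> is infinite but Bogomolov: an element
  \<open>x = a + b \<surd>p\<close>, where \<open>a\<close> and \<open>b \<noteq> 0\<close> lie in a field unramified at \<open>p\<close>, has the conjugate
  \<open>x' = a - b \<surd>p\<close>, and \<open>x - x'\<close> is divisible by \<open>\<surd>p\<close> at every place above \<open>p\<close>, up to the denominators
  of \<open>x\<close> and \<open>x'\<close>. By the product formula \<open>ln p / 2 \<le> ln 2 + 2 h(x)\<close>. Places above \<open>p\<close> are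
  replaced by a single valuation ring \<open>V\<close> of the complex numbers in which \<open>p\<close> is not invertible, applied
  to all conjugates of \<open>x\<close> at once. This settles (a) with \<open>K(\<surd>5)/K\<close> and (c). The remaining two cases are
  \<open>Qbar\<close> over its real subfield, with \<open>\<i>\<close> times real roots of \<open>2\<close> as small elements, and \<open>Qbar/K\<close>, with
  roots of \<open>5\<close>.
\<close>

section \<open>Subrings and subfields of the complex numbers\<close>

text \<open>The exponents 3^n and the condition p \<ge> 5 make every generator other than \<surd>p
  tame at p: p divides neither 2 nor 3^n, nor another prime q or the exponent 2 of its square root.
  The same condition makes ln p - ln 4 positive. The obstacle is that all conjugates of a and b must
  lie in one field unramified at p. Tame roots overcome it: their set is stable under conjugation,
  so one maximal unramified field serves every conjugate, and no embedding has to be extended.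
  Conjugation itself is elementary: numbers are written as rational polynomials in a primitive
  element g and evaluated at another root of its minimal polynomial. The product formula is replaced
  by two facts: a rational number lying in a valuation ring above each prime is an integer, and a
  nonzero integer has absolute value at least 1. The resulting bound is independent of the number of
  square roots adjoined, so one \<epsilon> serves the infinite extension.\<close>

definition ring_set :: "complex set \<Rightarrow> bool" where
  "ring_set R \<longleftrightarrow> 1 \<in> R \<and> (\<forall>x\<in>R. \<forall>y\<in>R. x - y \<in> R \<and> x * y \<in> R)"

lemma ring_set_1 [simp, intro]: "ring_set R \<Longrightarrow> 1 \<in> R"
  and ring_set_diff [intro]: "ring_set R \<Longrightarrow> x \<in> R \<Longrightarrow> y \<in> R \<Longrightarrow> x - y \<in> R"
  and ring_set_mult [intro]: "ring_set R \<Longrightarrow> x \<in> R \<Longrightarrow> y \<in> R \<Longrightarrow> x * y \<in> R"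
  by (auto simp: ring_set_def)

lemma ring_set_0 [simp, intro]: "ring_set R \<Longrightarrow> 0 \<in> R"
  using ring_set_diff[of R 1 1] by auto

lemma ring_set_uminus [intro]: "ring_set R \<Longrightarrow> x \<in> R \<Longrightarrow> - x \<in> R"
  using ring_set_diff[of R 0 x] by auto

lemma ring_set_add [intro]: "ring_set R \<Longrightarrow> x \<in> R \<Longrightarrow> y \<in> R \<Longrightarrow> x + y \<in> R"
  using ring_set_diff[of R x "- y"] by auto

lemma ring_set_power [intro]: "ring_set R \<Longrightarrow> x \<in> R \<Longrightarrow> x ^ n \<in> R"
  by (induction n) auto

lemma ring_set_of_nat [simp, intro]: "ring_set R \<Longrightarrow> of_nat n \<in> R"
  by (induction n) auto

lemma ring_set_of_int [simp, intro]: "ring_set R \<Longrightarrow> of_int k \<in> R"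
  by (cases k rule: int_cases2) auto

lemma ring_set_sum [intro]: "ring_set R \<Longrightarrow> (\<And>i. i \<in> I \<Longrightarrow> f i \<in> R) \<Longrightarrow> sum f I \<in> R"
  by (induction I rule: infinite_finite_induct) auto

lemma ring_set_prod_list [intro]: "ring_set R \<Longrightarrow> (\<And>x. x \<in> set xs \<Longrightarrow> f x \<in> R) \<Longrightarrow> (\<Prod>x\<leftarrow>xs. f x) \<in> R"
  by (induction xs) auto

lemma complex_field_simps:
  "carrier complex_field = UNIV" "monoid.mult complex_field = (*)" "add complex_field = (+)"
  "\<zero>\<^bsub>complex_field\<^esub> = 0" "\<one>\<^bsub>complex_field\<^esub> = 1"
  by (simp_all add: ring_of_type_algebra_def)

text \<open>Bridges the record-based algebra and plain sets, so that later closure arguments concern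
  only \<open>ring_set\<close> and \<open>inverse\<close>. Zero is included since
  \<open>inverse 0 = 0\<close>.\<close>

lemma is_field_iff: "is_field F \<longleftrightarrow> ring_set F \<and> (\<forall>x\<in>F. inverse x \<in> F)"
proof -
  interpret C: Ring.field complex_field by (rule field_from_type_algebra)
  have minus: "\<ominus>\<^bsub>complex_field\<^esub> x = - x" for x
    by (rule C.minus_equality) (auto simp: complex_field_simps)
  have inv: "inv\<^bsub>complex_field\<^esub> x = inverse x" if "x \<noteq> 0" for x
    by (rule C.comm_inv_char) (use that in \<open>auto simp: complex_field_simps\<close>)
  show ?thesis
  proof
    assume F: "is_field F"
    interpret F: subfield F complex_field by (rule F)
    have neg: "- x \<in> F" if "x \<in> F" for x
      using subringE(5)[OF F.subring_axioms that] minus[of x] by simp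
    have "x - y \<in> F" if "x \<in> F" "y \<in> F" for x y
      using subringE(7)[OF F.subring_axioms that(1) neg[OF that(2)]] by (simp add: complex_field_simps)
    moreover have "inverse x \<in> F" if "x \<in> F" for x
      using C.subfield_m_inv(1)[OF F, of x] inv[of x] that
      by (cases "x = 0") (auto simp: complex_field_simps)
    ultimately show "ring_set F \<and> (\<forall>x\<in>F. inverse x \<in> F)"
      using subringE(3,6)[OF F.subring_axioms] by (auto simp: ring_set_def complex_field_simps)
  next
    assume F: "ring_set F \<and> (\<forall>x\<in>F. inverse x \<in> F)"
    show "is_field F"
    proof (rule C.subfieldI')
      show "subring F complex_field"
        by (rule C.subringI) (use F in \<open>auto simp: complex_field_simps minus\<close>)
    qed (use F inv in \<open>auto simp: complex_field_simps\<close>)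
  qed
qed

lemma is_field_ring_set [simp, dest]: "is_field F \<Longrightarrow> ring_set F"
  and is_field_inverse [intro]: "is_field F \<Longrightarrow> x \<in> F \<Longrightarrow> inverse x \<in> F"
  by (auto simp: is_field_iff)

lemma is_field_divide [intro]: "is_field F \<Longrightarrow> x \<in> F \<Longrightarrow> y \<in> F \<Longrightarrow> x / y \<in> F"
  by (auto simp: divide_inverse)

lemma Rats_subset_is_field: "is_field F \<Longrightarrow> \<rat> \<subseteq> F"
  by (auto elim!: Rats_cases')

lemma is_field_Rats: "is_field \<rat>"
  by (auto simp: is_field_iff ring_set_def)

text \<open>An inductive closure rather than an intersection of subfields: its induction rule yields
  finite supports and, in \<open>conjugate_fgen\<close>, transports membership to
  conjugates.\<close>

inductive_set fgen :: "complex set \<Rightarrow> complex set" for S where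
  gen: "x \<in> S \<Longrightarrow> x \<in> fgen S"
| one: "1 \<in> fgen S"
| diff: "x \<in> fgen S \<Longrightarrow> y \<in> fgen S \<Longrightarrow> x - y \<in> fgen S"
| mult: "x \<in> fgen S \<Longrightarrow> y \<in> fgen S \<Longrightarrow> x * y \<in> fgen S"
| inverse: "x \<in> fgen S \<Longrightarrow> inverse x \<in> fgen S"

lemma is_field_fgen [simp, intro]: "is_field (fgen S)"
  by (auto simp: is_field_iff ring_set_def intro: fgen.intros)

lemma fgen_least: "S \<subseteq> F \<Longrightarrow> is_field F \<Longrightarrow> fgen S \<subseteq> F"
proof
  fix x assume "S \<subseteq> F" "is_field F" "x \<in> fgen S"
  from this(3,1,2) show "x \<in> F" by induction auto
qed

lemma fgen_mono: "S \<subseteq> T \<Longrightarrow> fgen S \<subseteq> fgen T"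
  by (intro fgen_least) (auto intro: fgen.gen)

lemma fgen_finite_support:
  assumes "x \<in> fgen S"
  shows "\<exists>T. finite T \<and> T \<subseteq> S \<and> x \<in> fgen T"
proof -
  have *: "\<exists>T. finite T \<and> T \<subseteq> S \<and> z \<in> fgen T"
    if "\<exists>T. finite T \<and> T \<subseteq> S \<and> x \<in> fgen T" "\<exists>T. finite T \<and> T \<subseteq> S \<and> y \<in> fgen T"
      "\<And>T. x \<in> fgen T \<Longrightarrow> y \<in> fgen T \<Longrightarrow> z \<in> fgen T" for x y z
  proof -
    from that obtain T T' where "finite T" "T \<subseteq> S" "x \<in> fgen T" "finite T'" "T' \<subseteq> S" "y \<in> fgen T'"
      by blast
    with that(3)[of "T \<union> T'"] fgen_mono[of T "T \<union> T'"] fgen_mono[of T' "T \<union> T'"]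
    show ?thesis by (intro exI[of _ "T \<union> T'"]) auto
  qed
  from assms show ?thesis
  proof induction
    case (gen x)
    then show ?case by (intro exI[of _ "{x}"]) (auto intro: fgen.gen)
  next
    case one
    then show ?case by (auto intro: fgen.one)
  next
    case (diff x y)
    show ?case by (rule *[OF diff.IH]) (rule fgen.diff)
  next
    case (mult x y)
    show ?case by (rule *[OF mult.IH]) (rule fgen.mult)
  next
    case (inverse x)
    show ?case by (rule *[OF inverse.IH inverse.IH]) (rule fgen.inverse)
  qed
qed

section \<open>Polynomials with coefficients in a subring\<close>

definition polys_over :: "complex set \<Rightarrow> complex poly set" where
  "polys_over R = {p. \<forall>i. coeff p i \<in> R}"

lemma polys_over_coeff: "p \<in> polys_over R \<Longrightarrow> coeff p i \<in> R"
  by (auto simp: polys_over_def)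

lemma polys_over_mono: "R \<subseteq> S \<Longrightarrow> polys_over R \<subseteq> polys_over S"
  by (auto simp: polys_over_def)

context
  fixes R assumes R: "ring_set R"
begin

lemma polys_over_0: "0 \<in> polys_over R"
  using R by (auto simp: polys_over_def)

lemma polys_over_pCons_iff: "pCons a p \<in> polys_over R \<longleftrightarrow> a \<in> R \<and> p \<in> polys_over R"
  using R by (auto simp: polys_over_def coeff_pCons split: nat.splits)

lemma polys_over_diff: "p \<in> polys_over R \<Longrightarrow> q \<in> polys_over R \<Longrightarrow> p - q \<in> polys_over R"
  using R by (auto simp: polys_over_def)

lemma polys_over_add: "p \<in> polys_over R \<Longrightarrow> q \<in> polys_over R \<Longrightarrow> p + q \<in> polys_over R"
  using R by (auto simp: polys_over_def)

lemma polys_over_mult: "p \<in> polys_over R \<Longrightarrow> q \<in> polys_over R \<Longrightarrow> p * q \<in> polys_over R"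
  using R by (auto simp: polys_over_def coeff_mult)

lemma polys_over_smult: "a \<in> R \<Longrightarrow> q \<in> polys_over R \<Longrightarrow> Polynomial.smult a q \<in> polys_over R"
  using R by (auto simp: polys_over_def)

lemma polys_over_monom: "a \<in> R \<Longrightarrow> Polynomial.monom a n \<in> polys_over R"
  using R by (auto simp: polys_over_def)

lemma polys_over_1: "1 \<in> polys_over R"
  using R by (auto simp: polys_over_def)

lemma polys_over_power: "p \<in> polys_over R \<Longrightarrow> p ^ n \<in> polys_over R"
  by (induction n) (auto simp: polys_over_mult polys_over_1)

lemma polys_over_pderiv: "p \<in> polys_over R \<Longrightarrow> pderiv p \<in> polys_over R"
  using R unfolding polys_over_def mem_Collect_eq coeff_pderiv
  by (metis ring_set_mult ring_set_of_nat)

lemma polys_over_of_int: "of_int_poly p \<in> polys_over R"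
  using R by (auto simp: polys_over_def)

lemma poly_polys_over: "p \<in> polys_over R \<Longrightarrow> x \<in> R \<Longrightarrow> poly p x \<in> R"
  unfolding poly_altdef by (intro ring_set_sum ring_set_mult ring_set_power R) (auto simp: polys_over_coeff)

lemma polys_over_pcompose: "p \<in> polys_over R \<Longrightarrow> q \<in> polys_over R \<Longrightarrow> pcompose p q \<in> polys_over R"
  by (induction p) (auto simp: polys_over_pCons_iff polys_over_0 pcompose_pCons
      intro!: polys_over_add polys_over_mult)

text \<open>Long division inverts only the leading coefficient of the divisor, so it also works over
  the maximal subring of \<open>ex_padic\<close> and over F \<inter> V, which are not
  fields.\<close>

lemma polys_over_div:
  assumes g: "g \<in> polys_over R" "g \<noteq> 0" "inverse (lead_coeff g) \<in> R" and s: "s \<in> polys_over R"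
  shows "\<exists>q\<in>polys_over R. \<exists>t\<in>polys_over R. s = g * q + t \<and> (t = 0 \<or> degree t < degree g)"
proof -
  have "\<forall>s. s \<in> polys_over R \<longrightarrow> degree s < n \<longrightarrow>
    (\<exists>q\<in>polys_over R. \<exists>t\<in>polys_over R. s = g * q + t \<and> (t = 0 \<or> degree t < degree g))" for n
  proof (induction n)
    case (Suc n)
    show ?case
    proof (intro allI impI)
      fix s assume s: "s \<in> polys_over R" "degree s < Suc n"
      show "\<exists>q\<in>polys_over R. \<exists>t\<in>polys_over R. s = g * q + t \<and> (t = 0 \<or> degree t < degree g)"
      proof (cases "s = 0 \<or> degree s < degree g")
        case True
        then show ?thesis using s polys_over_0 by (intro bexI[of _ 0] bexI[of _ s]) auto
      next
        case False
        define q where "q = Polynomial.monom (lead_coeff s * inverse (lead_coeff g)) (degree s - degree g)"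
        define s' where "s' = s - g * q"
        have q: "q \<in> polys_over R"
          unfolding q_def using s g R by (intro polys_over_monom) (auto simp: polys_over_coeff)
        have s': "s' \<in> polys_over R" unfolding s'_def using s g q by (auto intro: polys_over_diff polys_over_mult)
        have "lead_coeff s * inverse (lead_coeff g) \<noteq> 0" using False g by simp
        hence "q \<noteq> 0" "degree q = degree s - degree g"
          unfolding q_def by (auto intro: degree_monom_eq)
        hence "degree (g * q) = degree s" using False g by (simp add: degree_mult_eq)
        moreover have "lead_coeff (g * q) = lead_coeff s"
          using g unfolding lead_coeff_mult q_def lead_coeff_monom by simp
        ultimately have "s' = 0 \<or> degree s' < degree s"
          unfolding s'_def by (intro eq_zero_or_degree_less degree_diff_le) auto
        then obtain q' t where "q' \<in> polys_over R" "t \<in> polys_over R" "s' = g * q' + t"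
          "t = 0 \<or> degree t < degree g"
        proof
          assume "s' = 0" thus ?thesis using that[of 0 0] polys_over_0 by auto
        next
          assume "degree s' < degree s" thus ?thesis using Suc.IH s' s(2) that by fastforce
        qed
        moreover from this have "s = g * (q + q') + t" by (simp add: s'_def algebra_simps)
        ultimately show ?thesis using q polys_over_add by blast
      qed
    qed
  qed auto
  with s show ?thesis by blast
qed

end

lemma is_field_div:
  assumes "is_field F" "g \<in> polys_over F" "g \<noteq> 0" "s \<in> polys_over F"
  shows "\<exists>q\<in>polys_over F. \<exists>t\<in>polys_over F. s = g * q + t \<and> (t = 0 \<or> degree t < degree g)"
  using assms by (intro polys_over_div) (auto simp: polys_over_coeff)

lemma infinite_is_field: "is_field F \<Longrightarrow> infinite F"
proof
  assume "is_field F" and fin: "finite F"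
  hence "finite (range (of_nat :: nat \<Rightarrow> complex))"
    by (intro finite_subset[OF _ fin]) auto
  thus False using finite_imageD[of "of_nat :: nat \<Rightarrow> complex" UNIV] by (auto simp: inj_on_def)
qed

text \<open>Turns rational values into rational coefficients: a product over all roots of another
  polynomial is shown to be rational by evaluating it at rational points. The quotient of synthetic
  division at c has the values (p(x) - p(c)) / (x - c), which stay in F away from c; hence the
  growing exceptional set Z.\<close>

lemma polys_over_interpolate:
  assumes "is_field F" "finite Z" "\<And>x. x \<in> F - Z \<Longrightarrow> poly p x \<in> F"
  shows "p \<in> polys_over F"
  using assms(2,3)
proof (induction "degree p" arbitrary: p Z)
  case (0 p)
  have "infinite F" using assms(1) by (rule infinite_is_field)
  then obtain c where "c \<in> F - Z" using 0 by (meson finite_subset Diff_eq_empty_iff ex_in_conv)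
  moreover obtain a where "p = [:a:]" using 0 by (metis degree_eq_zeroE)
  ultimately show ?case using 0(3)[of c] assms(1) by (auto simp: polys_over_pCons_iff polys_over_0)
next
  case (Suc n p)
  have "infinite F" using assms(1) by (rule infinite_is_field)
  then obtain c where c: "c \<in> F - Z" using Suc.prems by (meson finite_subset Diff_eq_empty_iff ex_in_conv)
  define q where "q = synthetic_div p c"
  have p: "p = [:-c, 1:] * q + [:poly p c:]" unfolding q_def by (rule synthetic_div_correct'[symmetric])
  have "q \<in> polys_over F"
  proof (rule Suc.hyps(1))
    show "n = degree q" using Suc.hyps(2) by (simp add: q_def degree_synthetic_div)
    show "finite (insert c Z)" using Suc.prems by auto
    fix x assume x: "x \<in> F - insert c Z"
    have "poly p x = (x - c) * poly q x + poly p c" by (subst p) (simp add: algebra_simps)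
    hence "poly q x = (poly p x - poly p c) / (x - c)" using x by (simp add: eq_divide_eq mult.commute)
    thus "poly q x \<in> F" using x c assms(1) Suc.prems(2)[of x] Suc.prems(2)[of c] by auto
  qed
  thus ?case using assms(1) c Suc.prems(2)[of c]
    by (subst p, intro polys_over_add polys_over_mult)
      (auto simp: polys_over_pCons_iff polys_over_0 polys_over_1)
qed

section \<open>Products over the roots of a polynomial\<close>

lemma poly_complex_roots:
  "poly p x = lead_coeff p * (\<Prod>a\<leftarrow>complex_roots_complex p. x - a)"
  by (subst complex_roots(1)[of p, symmetric])
    (simp del: complex_roots add: poly_prod_list o_def)

lemma set_complex_roots: "p \<noteq> 0 \<Longrightarrow> set (complex_roots_complex p) = {x. poly p x = 0}"
  by (auto simp: poly_complex_roots prod_list_zero_iff)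

lemma prod_list_const: "(\<Prod>a\<leftarrow>as. c) = (c :: 'a :: comm_monoid_mult) ^ length as"
  by (induction as) auto

lemma prod_list_mult: "(\<Prod>a\<leftarrow>as. f a * g a) = (\<Prod>a\<leftarrow>as. f a) * (\<Prod>a\<leftarrow>as. g a :: 'a :: comm_monoid_mult)"
  by (induction as) (auto simp: ac_simps)

lemma prod_list_swap:
  "(\<Prod>a\<leftarrow>as. \<Prod>b\<leftarrow>bs. f a b) = (\<Prod>b\<leftarrow>bs. \<Prod>a\<leftarrow>as. f a b :: 'a :: comm_monoid_mult)"
  by (induction as) (auto simp: prod_list_mult prod_list_const)

text \<open>Exchanging the roles of the two polynomials (the resultant is symmetric up to sign) and
  reducing one modulo the other is the Euclidean algorithm.\<close>

lemma prod_roots_in_field: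
  assumes "is_field F" "p \<in> polys_over F" "q \<in> polys_over F"
  shows "(\<Prod>a\<leftarrow>complex_roots_complex p. poly q a) \<in> F"
  using assms(2,3)
proof (induction "degree p" arbitrary: p q rule: less_induct)
  case less
  show ?case
  proof (cases "degree p = 0")
    case True
    then obtain c where "p = [:c:]" by (metis degree_eq_zeroE)
    then show ?thesis using assms by simp
  next
    case False
    hence p0: "p \<noteq> 0" by auto
    obtain s t where st: "s \<in> polys_over F" "t \<in> polys_over F" "q = p * s + t" "t = 0 \<or> degree t < degree p"
      using is_field_div[OF assms(1) less.prems(1) p0 less.prems(2)] by blast
    have "(\<Prod>a\<leftarrow>complex_roots_complex p. poly q a) = (\<Prod>a\<leftarrow>complex_roots_complex p. poly t a)"
      by (intro arg_cong[of _ _ prod_list] map_cong refl) (use p0 in \<open>auto simp: st(3) set_complex_roots\<close>)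
    also have "\<dots> \<in> F"
    proof (cases "t = 0")
      case True
      then show ?thesis using assms(1) by (intro ring_set_prod_list) auto
    next
      case t0: False
      let ?P = "\<Prod>a\<leftarrow>complex_roots_complex p. \<Prod>b\<leftarrow>complex_roots_complex t. a - b"
      have "(\<Prod>b\<leftarrow>complex_roots_complex t. poly p b) \<in> F" using less.hyps[of t p] less.prems st t0 by auto
      also have "(\<Prod>b\<leftarrow>complex_roots_complex t. poly p b) =
         lead_coeff p ^ degree t * (\<Prod>b\<leftarrow>complex_roots_complex t. \<Prod>a\<leftarrow>complex_roots_complex p. (-1) * (a - b))"
        by (simp add: poly_complex_roots[of p] prod_list_mult prod_list_const)
      also have "\<dots> = lead_coeff p ^ degree t * (((-1) ^ degree p) ^ degree t * ?P)"
        by (simp only: prod_list_mult prod_list_const complex_roots(2)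
          prod_list_swap[where as = "complex_roots_complex p"])
      finally have *: "lead_coeff p ^ degree t * (((-1) ^ degree p) ^ degree t * ?P) \<in> F" .
      have "inverse (lead_coeff p ^ degree t * (((-1) ^ degree p) ^ degree t)) \<in> F"
        using assms(1) less.prems by (auto simp: polys_over_coeff intro!: is_field_inverse ring_set_mult
          ring_set_power ring_set_uminus)
      from ring_set_mult[OF _ this *] have P: "?P \<in> F" using assms(1) p0 by (simp add: field_simps)
      have "(\<Prod>a\<leftarrow>complex_roots_complex p. poly t a) = lead_coeff t ^ degree p * ?P"
        by (simp add: poly_complex_roots[of t] prod_list_mult prod_list_const)
      also have "\<dots> \<in> F" using st by (intro ring_set_mult ring_set_power P) (auto simp: polys_over_coeff assms(1))
      finally show ?thesis .
    qed
    finally show ?thesis .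
  qed
qed


section \<open>Algebraic numbers\<close>

lemma QbarE:
  assumes "x \<in> Qbar"
  obtains p where "p \<in> polys_over \<rat>" "p \<noteq> 0" "poly p x = 0"
  using assms unfolding Qbar_def algebraic_altdef polys_over_def by auto

lemma QbarI: "p \<in> polys_over \<rat> \<Longrightarrow> p \<noteq> 0 \<Longrightarrow> poly p x = 0 \<Longrightarrow> x \<in> Qbar"
  unfolding Qbar_def algebraic_altdef polys_over_def by auto

lemma ring_set_Rats [simp]: "ring_set \<rat>"
  using is_field_Rats by auto

lemma algebraicE_nonzero:
  assumes "algebraic (x :: complex)" "x \<noteq> 0"
  obtains p where "p \<in> polys_over \<rat>" "poly p x = 0" "coeff p 0 \<noteq> 0"
proof -
  from assms obtain p where "poly (of_int_poly p) x = 0" "coeff p 0 \<noteq> 0"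
    by (elim algebraicE'_nonzero)
  thus ?thesis by (intro that[of "of_int_poly p"] polys_over_of_int) auto
qed

lemma prod_list_poly_neq_0: "(\<And>a. a \<in> set as \<Longrightarrow> f a \<noteq> 0) \<Longrightarrow> (\<Prod>a\<leftarrow>as. f a) \<noteq> (0 :: complex poly)"
  by (induction as) auto

text \<open>The norm construction: h(Z) = \<Prod> q(a - Z) over the roots a of p vanishes at x - y.
  Its value at a rational r is a product of values of one rational polynomial over the roots of p,
  hence rational by \<open>prod_roots_in_field\<close>.\<close>

lemma is_field_Qbar: "is_field Qbar"
  unfolding is_field_iff ring_set_def
proof safe
  show "1 \<in> Qbar" by (simp add: Qbar_def)
next
  fix x y assume "x \<in> Qbar" "y \<in> Qbar"
  then obtain p q where p: "p \<in> polys_over \<rat>" "p \<noteq> 0" "poly p x = 0"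
    and q: "q \<in> polys_over \<rat>" "q \<noteq> 0" "poly q y = 0" by (metis QbarE)
  define h where "h = (\<Prod>a\<leftarrow>complex_roots_complex p. pcompose q [:a, -1:])"
  show "x - y \<in> Qbar"
  proof (rule QbarI)
    show "h \<noteq> 0"
      unfolding h_def using q by (intro prod_list_poly_neq_0) (simp add: pcompose_eq_0_iff)
    show "poly h (x - y) = 0"
      using p q by (auto simp: h_def poly_prod_list o_def poly_pcompose prod_list_zero_iff set_complex_roots
        intro!: image_eqI[of _ _ x])
    show "h \<in> polys_over \<rat>"
    proof (rule polys_over_interpolate[OF is_field_Rats finite.emptyI])
      fix r :: complex assume "r \<in> \<rat> - {}"
      hence "(\<Prod>a\<leftarrow>complex_roots_complex p. poly (pcompose q [:-r, 1:]) a) \<in> \<rat>"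
        using p q by (intro prod_roots_in_field is_field_Rats polys_over_pcompose)
          (auto simp: polys_over_pCons_iff polys_over_0 polys_over_1)
      thus "poly h r \<in> \<rat>" by (simp add: h_def poly_prod_list o_def poly_pcompose)
    qed
  qed
next
  fix x y assume x: "x \<in> Qbar" and y: "y \<in> Qbar"
  show "x * y \<in> Qbar"
  proof (cases "x = 0")
    case True
    then show ?thesis by (simp add: Qbar_def)
  next
    case False
    \<comment> \<open>For the product, p is taken with the root 1/x: the factor q(a Z) with a = 1/x
      vanishes at x y. The nonzero constant coefficient of p keeps every a, and with it every factor
      q(a Z), nonzero.\<close>
    with x have "algebraic (inverse x)" "inverse x \<noteq> 0" by (auto simp: Qbar_def)
    then obtain p where p: "p \<in> polys_over \<rat>" "poly p (inverse x) = 0" "coeff p 0 \<noteq> 0"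
      by (rule algebraicE_nonzero)
    hence p': "p \<in> polys_over \<rat>" "p \<noteq> 0" by auto
    from y obtain q where q: "q \<in> polys_over \<rat>" "q \<noteq> 0" "poly q y = 0" by (metis QbarE)
    define h where "h = (\<Prod>a\<leftarrow>complex_roots_complex p. pcompose q [:0, a:])"
    show ?thesis
    proof (rule QbarI)
      have "a \<noteq> 0" if "a \<in> set (complex_roots_complex p)" for a
        using that p p' by (auto simp: set_complex_roots poly_0_coeff_0)
      thus "h \<noteq> 0"
        unfolding h_def using q by (intro prod_list_poly_neq_0) (simp add: pcompose_eq_0_iff)
      have "poly q (x * y * inverse x) = 0" using False q by (simp add: mult.commute[of x y] mult.assoc)
      thus "poly h (x * y) = 0"
        using p p' q by (auto simp: h_def poly_prod_list o_def poly_pcompose prod_list_zero_iff set_complex_roots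
          intro!: image_eqI[of _ _ "inverse x"])
      show "h \<in> polys_over \<rat>"
      proof (rule polys_over_interpolate[OF is_field_Rats finite.emptyI])
        fix r :: complex assume "r \<in> \<rat> - {}"
        hence "(\<Prod>a\<leftarrow>complex_roots_complex p. poly (pcompose q [:0, r:]) a) \<in> \<rat>"
          using p' q by (intro prod_roots_in_field is_field_Rats polys_over_pcompose)
            (auto simp: polys_over_pCons_iff polys_over_0 polys_over_1)
        thus "poly h r \<in> \<rat>" by (simp add: h_def poly_prod_list o_def poly_pcompose mult.commute)
      qed
    qed
  qed
next
  fix x assume "x \<in> Qbar"
  thus "inverse x \<in> Qbar" by (auto simp: Qbar_def)
qed

text \<open>A rational relation c + x q(x) = 0 with c \<noteq> 0 gives 1/x = - q(x)/c, so the
  inverse is already a polynomial in x.\<close>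

lemma is_field_of_ring_in_Qbar:
  assumes "ring_set R" "\<rat> \<subseteq> R" "R \<subseteq> Qbar"
  shows "is_field R"
  unfolding is_field_iff
proof (intro conjI ballI)
  fix x assume x: "x \<in> R"
  show "inverse x \<in> R"
  proof (cases "x = 0")
    case False
    with x assms(3) have "algebraic x" by (auto simp: Qbar_def)
    then obtain p where p: "p \<in> polys_over \<rat>" "poly p x = 0" "coeff p 0 \<noteq> 0"
      using False by (rule algebraicE_nonzero)
    obtain a q where pq: "p = pCons a q" by (cases p)
    have "p \<in> polys_over R" using p(1) polys_over_mono[OF assms(2)] by auto
    hence q: "q \<in> polys_over R" using assms(1) by (simp add: pq polys_over_pCons_iff)
    have "a \<noteq> 0" "inverse a \<in> R" "a + x * poly q x = 0"
      using p polys_over_coeff[OF p(1), of 0] assms(2) by (auto simp: pq)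
    hence "inverse x = - inverse a * poly q x" using False
      by (simp add: field_simps add_eq_0_iff)
    thus ?thesis using \<open>inverse a \<in> R\<close> poly_polys_over[OF assms(1) q x] assms(1) by auto
  qed (use assms in auto)
qed (use assms in auto)

text \<open>The values of rational polynomials at g form a ring of algebraic numbers, hence a field.
  This representation is what makes conjugation available: the polynomial is evaluated at another
  root.\<close>

lemma fgen_singleton:
  assumes "g \<in> Qbar" "x \<in> fgen {g}"
  shows "\<exists>p\<in>polys_over \<rat>. x = poly p g"
proof -
  let ?R = "(\<lambda>p. poly p g) ` polys_over \<rat>"
  have "is_field ?R"
  proof (rule is_field_of_ring_in_Qbar)
    show "ring_set ?R"
      unfolding ring_set_def
      by (auto intro!: polys_over_1 polys_over_diff polys_over_mult image_eqI[of 1 _ 1]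
        simp flip: poly_diff poly_mult)
    have "x \<in> ?R" if "x \<in> \<rat>" for x
      using that by (auto intro!: image_eqI[of _ _ "[:x:]"] simp: polys_over_pCons_iff polys_over_0 polys_over_1)
    thus "\<rat> \<subseteq> ?R" by blast
    show "?R \<subseteq> Qbar"
      using polys_over_mono[OF Rats_subset_is_field[OF is_field_Qbar]] assms(1) is_field_Qbar
      by (auto intro!: poly_polys_over)
  qed
  moreover have "{g} \<subseteq> ?R"
    by (auto intro!: image_eqI[of _ _ "[:0, 1:]"] simp: polys_over_pCons_iff polys_over_0 polys_over_1)
  ultimately show ?thesis using fgen_least assms(2) by blast
qed

lemma fgen_in_Qbar: "S \<subseteq> Qbar \<Longrightarrow> fgen S \<subseteq> Qbar"
  by (rule fgen_least[OF _ is_field_Qbar])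

lemma degree_pos_if_root: "p \<noteq> 0 \<Longrightarrow> poly p x = 0 \<Longrightarrow> degree p > (0 :: nat)" for x :: complex
  by (metis degree_eq_zeroE gr0I pCons_0_0 poly_const_conv)

text \<open>For all but finitely many rational \<open>c\<close>, the only common root of \<open>q\<close> and
  \<open>p (x + c y - c Z)\<close> is \<open>y\<close>, so that the minimal polynomial of \<open>y\<close> over \<open>\<rat>(x + c y)\<close> is linear.\<close>

lemma primitive_element:
  assumes x: "x \<in> Qbar" and y: "y \<in> Qbar"
  shows "\<exists>g\<in>Qbar. x \<in> fgen {g} \<and> y \<in> fgen {g}"
proof -
  obtain p q where p: "p \<in> polys_over \<rat>" "p \<noteq> 0" "poly p x = 0"
    and q: "q \<in> polys_over \<rat>" "q \<noteq> 0" "poly q y = 0" using x y by (metis QbarE)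
  \<comment> \<open>The values c to avoid are those with x + c y - c b = a for a root a of p and a
    root b \<noteq> y of q. The pairs with b = y contribute (a - x) / 0 = 0 and so exclude c = 0 as
    well.\<close>
  define B where "B = (\<lambda>(a, b). (a - x) / (y - b)) ` ({a. poly p a = 0} \<times> {b. poly q b = 0})"
  have "finite B" using p q by (auto simp: B_def poly_roots_finite)
  moreover have "infinite (range (of_nat :: nat \<Rightarrow> complex))"
    by (rule range_inj_infinite) (auto simp: inj_on_def)
  ultimately obtain c where "c \<in> range (of_nat :: nat \<Rightarrow> complex) - B"
    by (meson finite_subset Diff_eq_empty_iff ex_in_conv)
  hence cQ: "c \<in> \<rat>" and cB: "c \<notin> B" by auto
  define g where "g = x + c * y"
  define E where "E = fgen {g}"
  have E: "is_field E" "ring_set E" "\<rat> \<subseteq> E" by (auto simp: E_def Rats_subset_is_field)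
  have gE: "g \<in> E" by (auto simp: E_def intro: fgen.gen)
  define M where "M = {s \<in> polys_over E. s \<noteq> 0 \<and> poly s y = 0}"
  have "q \<in> M" using q polys_over_mono[OF E(3)] by (auto simp: M_def)
  then obtain m where m: "m \<in> M" and min: "\<And>s. s \<in> M \<Longrightarrow> degree m \<le> degree s"
    using ex_has_least_nat[of "\<lambda>s. s \<in> M" q degree] by blast
  have m': "m \<in> polys_over E" "m \<noteq> 0" "poly m y = 0" using m by (auto simp: M_def)
  have dvd: "m dvd s" if s: "s \<in> polys_over E" "poly s y = 0" for s
  proof -
    obtain u t where ut: "t \<in> polys_over E" "s = m * u + t" "t = 0 \<or> degree t < degree m"
      using is_field_div[OF E(1) m'(1,2) s(1)] by blast
    from ut(2) s m' have "poly t y = 0" by simp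
    with ut(1,3) min[of t] have "t = 0" by (fastforce simp: M_def)
    with ut show ?thesis by simp
  qed
  have root: "z = y" if z: "poly m z = 0" for z
  proof (rule ccontr)
    assume "z \<noteq> y"
    have "poly q z = 0"
      using dvd[of q] q polys_over_mono[OF E(3)] z by (metis dvdE mult_zero_left poly_mult subsetD)
    moreover have "m dvd pcompose p [:g, -c:]"
    proof (rule dvd)
      show "pcompose p [:g, -c:] \<in> polys_over E"
        using p(1) polys_over_mono[OF E(3)] gE cQ E
        by (intro polys_over_pcompose) (auto simp: polys_over_pCons_iff polys_over_0 polys_over_1)
      show "poly (pcompose p [:g, -c:]) y = 0" using p(3) by (simp add: poly_pcompose g_def algebra_simps)
    qed
    hence "poly p (g - c * z) = 0"
      using z by (auto elim!: dvdE simp: poly_pcompose dest!: arg_cong[of _ _ "\<lambda>s. poly s z"] simp: algebra_simps)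
    ultimately have "(g - c * z - x) / (y - z) \<in> B" unfolding B_def by (auto intro!: rev_image_eqI)
    also have "(g - c * z - x) / (y - z) = c" using \<open>z \<noteq> y\<close> by (simp add: g_def field_simps)
    finally show False using cB by blast
  qed
  have deg: "degree m > 0" using m' by (intro degree_pos_if_root)
  obtain u where u: "m = [:-y, 1:] * u" using m'(3) unfolding poly_eq_0_iff_dvd by (elim dvdE)
  \<comment> \<open>By \<open>root\<close>, any root of u is y again; then y is a double root of m,
    and \<open>pderiv m\<close> is an element of M of smaller degree.\<close>
  have "degree u = 0"
  proof (rule ccontr)
    assume "degree u \<noteq> 0"
    then obtain z where "poly u z = 0" using fundamental_theorem_of_algebra[of u]
      by (auto simp: constant_degree)
    moreover from this have "z = y" using root by (simp add: u)
    ultimately have "poly (pderiv m) y = 0" unfolding u pderiv_mult by simp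
    moreover have "pderiv m \<noteq> 0" using deg by (auto simp: pderiv_eq_0_iff)
    ultimately have "pderiv m \<in> M" using m' E(2) by (auto simp: M_def polys_over_pderiv)
    from min[OF this] deg show False by (simp add: degree_pderiv)
  qed
  then obtain l where "u = [:l:]" by (metis degree_eq_zeroE)
  with u m' have l: "m = [:- y * l, l:]" "l \<noteq> 0" by auto
  hence "y * l \<in> E" "l \<in> E"
    using m'(1) E(2) ring_set_uminus[of E "- (y * l)"] by (auto simp: polys_over_pCons_iff)
  hence yE: "y \<in> E" using is_field_divide[OF E(1), of "y * l" l] l(2) by simp
  moreover have "x = g - c * y" by (simp add: g_def)
  hence "x \<in> E" using gE yE cQ E by auto
  moreover have "g \<in> Qbar"
    using x y cQ is_field_Qbar Rats_subset_is_field[OF is_field_Qbar] by (auto simp: g_def)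
  ultimately show ?thesis by (auto simp: E_def)
qed

lemma primitive_element_finite:
  assumes "finite T" "T \<subseteq> Qbar"
  shows "\<exists>g\<in>Qbar. T \<subseteq> fgen {g}"
  using assms
proof (induction T)
  case empty
  then show ?case using is_field_Qbar by auto
next
  case (insert x T)
  then obtain g where g: "g \<in> Qbar" "T \<subseteq> fgen {g}" by auto
  with insert.prems obtain g' where g': "g' \<in> Qbar" "x \<in> fgen {g'}" "g \<in> fgen {g'}"
    using primitive_element[of x g] by auto
  with g have "T \<subseteq> fgen {g'}" using fgen_least[of "{g}" "fgen {g'}"] by auto
  with g' show ?case by auto
qed

section \<open>Minimal polynomials over the integers and conjugates\<close>

lemma clear_denominators:
  assumes "p \<in> polys_over \<rat>"
  shows "\<exists>m q. m > 0 \<and> Polynomial.smult (of_int m) p = of_int_poly q"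
  using assms
proof (induction p)
  case 0
  show ?case by (intro exI[of _ 1] exI[of _ 0]) auto
next
  case (pCons a p)
  then obtain m q where mq: "m > 0" "Polynomial.smult (of_int m) p = of_int_poly q" "a \<in> \<rat>"
    by (auto simp: polys_over_pCons_iff)
  from mq(3) obtain u v where uv: "v > 0" "a = of_int u / of_int v" by (metis Rats_cases')
  show ?case
  proof (intro exI[of _ "v * m"] exI[of _ "pCons (m * u) (Polynomial.smult v q)"] conjI)
    show "Polynomial.smult (of_int (v * m)) (pCons a p) = of_int_poly (pCons (m * u) (Polynomial.smult v q))"
      using uv by (simp add: mq(2)[symmetric] of_int_hom.map_poly_pCons_hom of_int_hom.map_poly_hom_smult)
  qed (use mq uv in auto)
qed

text \<open>Some prime factor of g vanishes at x, and irreducible integer polynomials with a common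
  root divide each other.\<close>

lemma min_int_poly_dvd:
  assumes x: "x \<in> Qbar" and g: "poly (of_int_poly g) x = 0"
  shows "min_int_poly x dvd g"
proof (cases "g = 0")
  case False
  have "poly (of_int_poly (prod_mset (prime_factorization g))) x = 0"
    using prod_mset_prime_factorization_weak[OF False] g
    by (metis dvd_def dvd_refl normalize_dvd_iff of_int_poly_hom.hom_mult mult_zero_left poly_mult
        dvd_normalize_iff)
  moreover have "poly (of_int_poly (prod_mset M)) x = 0 \<Longrightarrow>
      \<exists>p \<in># M. poly (of_int_poly p) x = 0" for M :: "int poly multiset"
    by (induction M) (auto simp: of_int_poly_hom.hom_mult)
  ultimately obtain p where p: "p \<in># prime_factorization g" "poly (of_int_poly p) x = 0" by blast
  hence "p dvd g" "prime p" by auto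
  hence "comm_semiring_1_class.irreducible p" "p \<noteq> 0"
    by (auto simp: prime_def prime_elem_imp_irreducible)
  hence "min_int_poly x dvd p"
    using is_min_int_poly_min_int_poly[OF x] p
    by (intro irreducible_int_root_dvd[of _ x]) (auto simp: is_min_int_poly_def)
  with \<open>p dvd g\<close> show ?thesis by (rule dvd_trans[rotated])
qed auto

lemma min_int_poly_neq_0: "x \<in> Qbar \<Longrightarrow> min_int_poly x \<noteq> 0"
  and poly_min_int_poly: "x \<in> Qbar \<Longrightarrow> poly (of_int_poly (min_int_poly x)) x = 0"
  and lead_coeff_min_int_poly: "x \<in> Qbar \<Longrightarrow> lead_coeff (min_int_poly x) > 0"
  using is_min_int_poly_min_int_poly[of x] by (auto simp: is_min_int_poly_def)

lemma degree_min_int_poly_pos: "x \<in> Qbar \<Longrightarrow> degree (min_int_poly x) > 0"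
  by (intro degree_pos_of_int_root[of _ x]) (auto simp: min_int_poly_neq_0 poly_min_int_poly)

lemma min_int_poly_conjugate:
  assumes "x \<in> Qbar" "poly (of_int_poly (min_int_poly x)) y = 0"
  shows "y \<in> Qbar" "min_int_poly y = min_int_poly x"
proof -
  show y: "y \<in> Qbar"
    using assms min_int_poly_neq_0[OF assms(1)]
    by (intro QbarI[of "of_int_poly (min_int_poly x)"] polys_over_of_int) auto
  show "min_int_poly y = min_int_poly x"
    using ex1_min_int_poly[OF y] is_min_int_poly_min_int_poly[OF y] is_min_int_poly_min_int_poly[OF assms(1)] assms(2)
    by (auto simp: is_min_int_poly_def)
qed

text \<open>Replaces the isomorphism from \<rat>(x) to \<rat>(y): \<open>poly p x\<close> is sent to
  \<open>poly p y\<close>, and \<open>poly_conjugate_eq\<close> says that this is well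
  defined.\<close>

lemma poly_conjugate_zero:
  assumes "x \<in> Qbar" "poly (of_int_poly (min_int_poly x)) y = 0" "p \<in> polys_over \<rat>" "poly p x = 0"
  shows "poly p y = 0"
proof -
  obtain m q where mq: "m > 0" "Polynomial.smult (of_int m) p = of_int_poly q"
    using clear_denominators[OF assms(3)] by blast
  have "poly (of_int_poly q) x = 0" unfolding mq(2)[symmetric] using assms(4) by simp
  hence "min_int_poly x dvd q" by (rule min_int_poly_dvd[OF assms(1)])
  hence "poly (of_int_poly q) y = 0" using assms(2) by (auto elim!: dvdE simp: of_int_poly_hom.hom_mult)
  thus ?thesis unfolding mq(2)[symmetric] using mq(1) by simp
qed

lemma poly_conjugate_eq:
  assumes "x \<in> Qbar" "poly (of_int_poly (min_int_poly x)) y = 0" "p \<in> polys_over \<rat>" "q \<in> polys_over \<rat>"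
    "poly p x = poly q x"
  shows "poly p y = poly q y"
  using poly_conjugate_zero[OF assms(1,2) polys_over_diff[OF ring_set_Rats assms(3,4)]] assms(5) by simp

text \<open>The isomorphism from \<rat>(x) to \<rat>(y) maps \<open>fgen T\<close> into F as soon as
  it maps T into F. The induction produces one representing polynomial with value in F at y;
  well-definedness carries this over to the given p.\<close>

lemma conjugate_fgen:
  assumes x: "x \<in> Qbar" "poly (of_int_poly (min_int_poly x)) y = 0"
    and F: "is_field F" and T: "T \<subseteq> fgen {x}"
    and conj: "\<And>p. p \<in> polys_over \<rat> \<Longrightarrow> poly p x \<in> T \<Longrightarrow> poly p y \<in> F"
    and z: "z \<in> fgen T" "p \<in> polys_over \<rat>" "z = poly p x"
  shows "poly p y \<in> F"
proof -
  from z(1) have "\<exists>p\<in>polys_over \<rat>. z = poly p x \<and> poly p y \<in> F"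
  proof induction
    case (gen z)
    then obtain p where "p \<in> polys_over \<rat>" "z = poly p x" using fgen_singleton[OF x(1)] T by blast
    then show ?case using conj gen by blast
  next
    case one
    show ?case using F by (intro bexI[of _ 1]) (auto intro: polys_over_1)
  next
    case (diff u v)
    then obtain p q where "p \<in> polys_over \<rat>" "u = poly p x" "poly p y \<in> F"
      "q \<in> polys_over \<rat>" "v = poly q x" "poly q y \<in> F" by blast
    then show ?case using F by (intro bexI[of _ "p - q"]) (auto intro: polys_over_diff)
  next
    case (mult u v)
    then obtain p q where "p \<in> polys_over \<rat>" "u = poly p x" "poly p y \<in> F"
      "q \<in> polys_over \<rat>" "v = poly q x" "poly q y \<in> F" by blast
    then show ?case using F by (intro bexI[of _ "p * q"]) (auto intro: polys_over_mult)
  next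
    case (inverse u)
    then obtain p where p: "p \<in> polys_over \<rat>" "u = poly p x" "poly p y \<in> F" by blast
    show ?case
    proof (cases "u = 0")
      case True
      then show ?thesis using p F by (intro bexI[of _ 0]) (auto intro: polys_over_0)
    next
      case False
      have "u \<in> fgen {x}" using inverse.hyps fgen_least[OF T] by auto
      hence "Fields.inverse u \<in> fgen {x}" by (rule fgen.inverse)
      then obtain q where q: "q \<in> polys_over \<rat>" "Fields.inverse u = poly q x"
        using fgen_singleton[OF x(1)] by blast
      have "poly (p * q) y = poly 1 y"
        using p q False by (intro poly_conjugate_eq[OF x]) (auto intro: polys_over_mult polys_over_1 simp flip: q(2))
      hence "poly q y = Fields.inverse (poly p y)" by (simp add: inverse_unique)
      then show ?thesis using q p F by (intro bexI[of _ q]) auto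
    qed
  qed
  then obtain q where "q \<in> polys_over \<rat>" "z = poly q x" "poly q y \<in> F" by blast
  with poly_conjugate_eq[OF x, of p q] z show ?thesis by auto
qed

text \<open>Every root of g is a conjugate of x, so the minimal polynomial of x can be split off
  until a constant remains.\<close>

lemma int_poly_power_of_irreducible:
  fixes g :: "int poly"
  assumes x: "x \<in> Qbar" and "g \<noteq> 0"
    and "\<And>z. poly (of_int_poly g) z = 0 \<Longrightarrow> poly (of_int_poly (min_int_poly x)) z = (0 :: complex)"
  shows "\<exists>c k. c \<noteq> 0 \<and> g = Polynomial.smult c (min_int_poly x ^ k)"
  using assms(2-)
proof (induction "degree g" arbitrary: g rule: less_induct)
  case less
  show ?case
  proof (cases "degree g = 0")
    case True
    then obtain c where "g = [:c:]" by (metis degree_eq_zeroE)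
    then show ?thesis using less.prems by (intro exI[of _ c] exI[of _ 0]) auto
  next
    case False
    hence "\<not> constant (poly (of_int_poly g :: complex poly))" by (simp add: constant_degree)
    then obtain z :: complex where z: "poly (of_int_poly g) z = 0"
      using fundamental_theorem_of_algebra by blast
    with less.prems have "poly (of_int_poly (min_int_poly x)) z = 0" by blast
    from min_int_poly_conjugate[OF x this] min_int_poly_dvd[of z g] z
    have "min_int_poly x dvd g" by simp
    then obtain h where h: "g = min_int_poly x * h" ..
    have "h \<noteq> 0" using less.prems h by auto
    have "\<exists>c k. c \<noteq> 0 \<and> h = Polynomial.smult c (min_int_poly x ^ k)"
    proof (rule less.hyps)
      show "degree h < degree g"
        using \<open>h \<noteq> 0\<close> min_int_poly_neq_0[OF x] degree_min_int_poly_pos[OF x] by (simp add: h degree_mult_eq)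
      show "h \<noteq> 0" by fact
      show "poly (of_int_poly (min_int_poly x)) w = 0" if "poly (of_int_poly h) w = 0" for w :: complex
        using that less.prems(2)[of w] by (simp add: h of_int_poly_hom.hom_mult)
    qed
    then obtain c k where "c \<noteq> 0" "h = Polynomial.smult c (min_int_poly x ^ k)" by blast
    thus ?thesis by (intro exI[of _ c] exI[of _ "Suc k"]) (auto simp: h)
  qed
qed

text \<open>The characteristic polynomial of \<open>poly p g\<close> relative to \<rat>(g) is
  rational, its values being norms, and all its roots are conjugates of x. Only conjugacy to x is
  assumed of the values of p, so the lemma serves both x = P(g) and its conjugate P'(g).\<close>

lemma char_poly_power:
  assumes g: "g \<in> Qbar" and p: "p \<in> polys_over \<rat>" and x: "x \<in> Qbar"
    and conj: "\<And>y. poly (of_int_poly (min_int_poly g)) y = 0 \<Longrightarrow> poly (of_int_poly (min_int_poly x)) (poly p y) = 0"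
  defines "d \<equiv> degree (min_int_poly g)" and "ys \<equiv> complex_roots_int (min_int_poly g)"
  shows "\<exists>k. d = k * degree (min_int_poly x) \<and>
    Polynomial.smult (of_int (lead_coeff (min_int_poly x)) ^ k) (\<Prod>y\<leftarrow>ys. [:- poly p y, 1:]) = of_int_poly (min_int_poly x) ^ k"
proof -
  define h where "h = (\<Prod>y\<leftarrow>ys. [:- poly p y, 1:])"
  have roots: "set ys = {y. poly (of_int_poly (min_int_poly g)) y = 0}"
    using min_int_poly_neq_0[OF g] by (simp add: ys_def complex_roots_int_def set_complex_roots)
  have "h \<in> polys_over \<rat>"
  proof (rule polys_over_interpolate[OF is_field_Rats finite.emptyI])
    fix r :: complex assume "r \<in> \<rat> - {}"
    hence "(\<Prod>y\<leftarrow>ys. poly ([:r:] - p) y) \<in> \<rat>"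
      unfolding ys_def complex_roots_int_def
      using p by (intro prod_roots_in_field is_field_Rats polys_over_of_int polys_over_diff)
        (auto simp: polys_over_pCons_iff polys_over_0 polys_over_1)
    thus "poly h r \<in> \<rat>" by (simp add: h_def poly_prod_list o_def)
  qed
  then obtain m q where mq: "m > 0" "Polynomial.smult (of_int m) h = of_int_poly q"
    using clear_denominators by blast
  have h0: "h \<noteq> 0" unfolding h_def by (intro prod_list_poly_neq_0) auto
  hence "q \<noteq> 0" using mq by auto
  moreover have "poly (of_int_poly (min_int_poly x)) z = 0" if "poly (of_int_poly q) z = 0" for z :: complex
  proof -
    have "poly h z = 0" using that mq(1) by (simp flip: mq(2))
    then obtain y where "y \<in> set ys" "z = poly p y" by (auto simp: h_def poly_prod_list o_def prod_list_zero_iff)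
    thus ?thesis using conj roots by auto
  qed
  ultimately obtain c k where ck: "c \<noteq> 0" "q = Polynomial.smult c (min_int_poly x ^ k)"
    using int_poly_power_of_irreducible[OF x] by blast
  have lh: "lead_coeff h = 1" unfolding h_def by (induction ys) (auto simp: lead_coeff_mult simp del: mult_pCons_left)
  have dh: "degree h = length ys"
    unfolding h_def by (rule degree_linear_factors)
  have eq: "Polynomial.smult (of_int m) h = Polynomial.smult (of_int c) (of_int_poly (min_int_poly x) ^ k)"
    by (simp add: mq(2) ck(2) of_int_hom.map_poly_hom_smult of_int_poly_hom.hom_power)
  have "degree h = k * degree (min_int_poly x)"
    using arg_cong[OF eq, of degree] mq(1) ck(1) by (simp add: degree_power_eq min_int_poly_neq_0[OF x])
  moreover have "(of_int m :: complex) = of_int c * of_int (lead_coeff (min_int_poly x)) ^ k"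
    using arg_cong[OF eq, of lead_coeff, unfolded lead_coeff_smult lead_coeff_power lh] by simp
  ultimately have d: "d = k * degree (min_int_poly x)"
    and eq2: "Polynomial.smult (of_int c) (Polynomial.smult (of_int (lead_coeff (min_int_poly x)) ^ k) h) =
      Polynomial.smult (of_int c) (of_int_poly (min_int_poly x) ^ k)"
    using eq by (simp_all add: d_def dh ys_def complex_roots_int_def)
  have "(of_int c :: complex) \<noteq> 0" using ck(1) by simp
  from injD[OF smult_inj[OF this] eq2] d show ?thesis unfolding h_def by blast
qed

section \<open>Valuation rings above a prime\<close>

lemma ring_set_poly_image:
  assumes R: "ring_set R"
  shows "ring_set ((\<lambda>q. poly q x) ` polys_over R)"
    and "R \<subseteq> (\<lambda>q. poly q x) ` polys_over R" and "x \<in> (\<lambda>q. poly q x) ` polys_over R"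
proof -
  show "ring_set ((\<lambda>q. poly q x) ` polys_over R)"
    unfolding ring_set_def using R
    by (auto intro!: polys_over_1 polys_over_diff polys_over_mult image_eqI[of 1 _ 1]
      simp flip: poly_diff poly_mult)
  show "R \<subseteq> (\<lambda>q. poly q x) ` polys_over R"
    using R by (auto intro!: image_eqI[of _ _ "[:r:]" for r] simp: polys_over_pCons_iff polys_over_0)
  show "x \<in> (\<lambda>q. poly q x) ` polys_over R"
    using R by (auto intro!: image_eqI[of _ _ "[:0, 1:]"] simp: polys_over_pCons_iff polys_over_0 polys_over_1)
qed

lemma ring_set_localization:
  assumes R: "ring_set R" and c: "c \<in> R" "c \<noteq> 0"
  shows "ring_set {r * inverse c ^ k | r k. r \<in> R}"
proof -
  let ?L = "{r * inverse c ^ k | r k. r \<in> R}"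
  have "1 \<in> ?L" using R by (intro CollectI exI[of _ "1 :: complex"] exI[of _ "0 :: nat"]) simp
  moreover have "z - z' \<in> ?L" "z * z' \<in> ?L" if z: "z \<in> ?L" "z' \<in> ?L" for z z'
  proof -
    from z obtain r k r' k' where r: "r \<in> R" "r' \<in> R" "z = r * inverse c ^ k" "z' = r' * inverse c ^ k'" by blast
    have "z - z' = (r * c ^ k' - r' * c ^ k) * inverse c ^ (k + k')"
      using c by (simp add: r power_add field_simps)
    moreover have "r * c ^ k' - r' * c ^ k \<in> R" using r R c by auto
    ultimately show "z - z' \<in> ?L" by blast
    have "z * z' = (r * r') * inverse c ^ (k + k')" by (simp add: r power_add)
    moreover have "r * r' \<in> R" using r R by auto
    ultimately show "z * z' \<in> ?L" by blast
  qed
  ultimately show ?thesis unfolding ring_set_def by blast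
qed

lemma degree_monom_minus_const: "n > 0 \<Longrightarrow> degree (Polynomial.monom 1 n - [:a:] :: complex poly) = n"
  unfolding diff_conv_add_uminus by (subst degree_add_eq_left) (auto simp: degree_monom_eq)

lemma root_of_int_in_Qbar:
  assumes "x ^ n = of_int u" "n > 0"
  shows "x \<in> Qbar"
proof -
  have "degree (Polynomial.monom 1 n - [:of_int u:] :: complex poly) = n"
    using assms(2) by (rule degree_monom_minus_const)
  hence "Polynomial.monom 1 n - [:of_int u:] \<noteq> (0 :: complex poly)" using assms(2) by auto
  thus ?thesis using assms(1)
    by (intro QbarI[of "Polynomial.monom 1 n - [:of_int u:]"])
      (auto intro!: polys_over_diff polys_over_monom simp: polys_over_pCons_iff polys_over_0 poly_monom)
qed

text \<open>V plays the role of a place above p, extended to all complex numbers; it meets \<rat> in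
  the localization of the integers at p. No value group is introduced: |x| \<le> |y| is expressed as
  x / y \<in> V.\<close>

locale padic =
  fixes p :: nat and V :: "complex set"
  assumes prime_p: "prime p" and ring_V: "ring_set V"
    and inverse_p: "inverse (of_nat p) \<notin> V" and total: "x \<in> V \<or> inverse x \<in> V"

text \<open>A maximal subring among those not containing \<open>1/p\<close> is a valuation ring.\<close>

lemma ex_padic:
  assumes p: "prime p"
  shows "\<exists>V. padic p V"
proof -
  define A where "A = {R. ring_set R \<and> inverse (of_nat p) \<notin> R}"
  have p0: "of_nat p \<noteq> (0 :: complex)" using p by auto
  have "\<int> \<in> A"
  proof -
    have "inverse (of_nat p :: complex) \<notin> \<int>"
    proof
      assume "inverse (of_nat p :: complex) \<in> \<int>"
      then obtain k where "inverse (of_nat p :: complex) = of_int k" by (auto elim: Ints_cases)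
      hence "(of_int (int p * k) :: complex) = of_int 1" using p0 by (simp add: field_simps)
      hence "int p * k = 1" by (simp only: of_int_eq_iff)
      thus False using p by (metis abs_zmult_eq_1 abs_of_nat nat_int not_prime_1 of_nat_1)
    qed
    thus ?thesis by (auto simp: A_def ring_set_def)
  qed
  moreover have "\<Union>C \<in> A" if C: "C \<noteq> {}" "subset.chain A C" for C
  proof -
    have ring: "ring_set R" "inverse (of_nat p) \<notin> R" if "R \<in> C" for R
      using that C by (auto simp: A_def subset_chain_def)
    have "\<exists>R\<in>C. x \<in> R \<and> y \<in> R" if xy: "x \<in> \<Union>C" "y \<in> \<Union>C" for x y
    proof -
      from xy obtain S T where "S \<in> C" "x \<in> S" "T \<in> C" "y \<in> T" by blast
      moreover from this have "S \<subseteq> T \<or> T \<subseteq> S" using C(2) by (auto simp: subset_chain_def)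
      ultimately show ?thesis by blast
    qed
    moreover have "1 \<in> \<Union>C" using C(1) ring(1) by auto
    moreover have "x - y \<in> \<Union>C \<and> x * y \<in> \<Union>C" if "R \<in> C" "x \<in> R" "y \<in> R" for x y R
      using that ring(1)[OF that(1)] by blast
    ultimately have "ring_set (\<Union>C)" unfolding ring_set_def by meson
    thus ?thesis using ring by (auto simp: A_def)
  qed
  ultimately obtain R where R: "R \<in> A" and max: "\<And>R'. R' \<in> A \<Longrightarrow> R \<subseteq> R' \<Longrightarrow> R' = R"
    using subset_Zorn_nonempty[of A] by blast
  have ring: "ring_set R" and pR: "inverse (of_nat p) \<notin> R" using R by (auto simp: A_def)
  \<comment> \<open>Localizing R at 1 - p b produces no 1/p, because the powers of 1 - p b are 1
    modulo p. By maximality the localization is R itself.\<close>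
  have unit: "inverse (1 - of_nat p * b) \<in> R" "1 - of_nat p * b \<noteq> 0" if b: "b \<in> R" for b
  proof -
    define c where "c = 1 - of_nat p * b"
    have c: "c \<in> R" using ring b by (auto simp: c_def)
    show "1 - of_nat p * b \<noteq> 0"
    proof
      assume "1 - of_nat p * b = 0"
      hence "b = inverse (of_nat p)" using p0 by (simp add: field_simps)
      with b pR show False by simp
    qed
    hence c0: "c \<noteq> 0" by (simp add: c_def)
    define R' where "R' = {r * inverse c ^ k | r k. r \<in> R}"
    have "inverse (of_nat p) \<notin> R'"
    proof
      assume "inverse (of_nat p) \<in> R'"
      then obtain r k where r: "r \<in> R" "inverse (of_nat p) = r * inverse c ^ k" by (auto simp: R'_def)
      hence *: "c ^ k = of_nat p * r" using p0 c0 by (simp add: field_simps)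
      have "\<exists>b'\<in>R. c ^ k = 1 - of_nat p * b'"
      proof (induction k)
        case (Suc k)
        then obtain b' where b': "b' \<in> R" "c ^ k = 1 - of_nat p * b'" by blast
        have "c ^ Suc k = 1 - of_nat p * (b + b' - of_nat p * (b * b'))"
          by (simp add: b'(2)) (simp add: c_def algebra_simps)
        moreover have "b + b' - of_nat p * (b * b') \<in> R" using ring b b' by auto
        ultimately show ?case by blast
      qed (use ring in \<open>auto intro!: bexI[of _ 0]\<close>)
      then obtain b' where b': "b' \<in> R" "c ^ k = 1 - of_nat p * b'" by blast
      with * have "of_nat p * (r + b') = 1" by (simp add: algebra_simps)
      hence "inverse (of_nat p) = r + b'" by (rule inverse_unique)
      moreover have "r + b' \<in> R" using ring r b' by blast
      ultimately show False using pR by simp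
    qed
    moreover have "ring_set R'" unfolding R'_def using ring c c0 by (rule ring_set_localization)
    moreover have "r * inverse c ^ k \<in> R'" if "r \<in> R" for r k using that by (auto simp: R'_def)
    from this[of _ 0] this[of 1 1] have "R \<subseteq> R'" "inverse c \<in> R'" using ring by auto
    ultimately have "R' = R" by (intro max) (auto simp: A_def)
    with \<open>inverse c \<in> R'\<close> show "inverse (1 - of_nat p * b) \<in> R" by (simp add: c_def)
  qed
  have "x \<in> R \<or> inverse x \<in> R" for x
  proof (rule ccontr)
    assume "\<not> (x \<in> R \<or> inverse x \<in> R)"
    hence x: "x \<notin> R" "inverse x \<notin> R" by auto
    hence x0: "x \<noteq> 0" using ring by auto
    \<comment> \<open>For y \<notin> R, maximality puts 1/p into R[y], that is, 1 = p q(y) for some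
      q over R. Among these relations for x and for 1/x, one of least degree is chosen.\<close>
    define Q where "Q = (\<lambda>q y. q \<in> polys_over R \<and> 1 = of_nat p * poly q y)"
    have ex: "\<exists>q. Q q y" if y: "y \<notin> R" for y
    proof -
      let ?R = "(\<lambda>q. poly q y) ` polys_over R"
      note * = ring_set_poly_image[OF ring, of y]
      have "?R \<noteq> R" using * y by auto
      hence "?R \<notin> A" using max * by blast
      hence "inverse (of_nat p) \<in> ?R" using * by (auto simp: A_def)
      thus ?thesis using p0 by (auto simp: Q_def field_simps)
    qed
    define N where "N = {(q, y). Q q y \<and> (y = x \<or> y = inverse x)}"
    obtain q1 where "Q q1 x" using ex x by blast
    hence "(q1, x) \<in> N" by (auto simp: N_def)
    then obtain qy where "qy \<in> N" and min': "\<And>rz. rz \<in> N \<Longrightarrow> degree (fst qy) \<le> degree (fst rz)"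
      using ex_has_least_nat[of "\<lambda>z. z \<in> N" "(q1, x)" "\<lambda>z. degree (fst z)"] by blast
    then obtain q y where qy: "(q, y) \<in> N" and min: "\<And>r z. (r, z) \<in> N \<Longrightarrow> degree q \<le> degree r"
      by (cases qy) fastforce
    have y0: "y \<noteq> 0" and y: "Q q y" "inverse y \<notin> R" "inverse y = x \<or> inverse y = inverse x"
      using qy x x0 by (auto simp: N_def)
    from ex[OF y(2)] obtain r where r: "Q r (inverse y)" by blast
    \<comment> \<open>Dividing 1 = p q(y) by the power y^(deg q) gives W(1/y) = 0. The leading
      coefficient 1 - p q(0) of W is a unit, so the relation for 1/y can be reduced modulo W to a
      degree below that of q, against minimality.\<close>
    define W where "W = Polynomial.monom 1 (degree q) - Polynomial.smult (of_nat p) (reflect_poly q)"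
    have q: "q \<in> polys_over R" using y by (auto simp: Q_def)
    have W: "W \<in> polys_over R"
      unfolding W_def using ring q
      by (intro polys_over_diff polys_over_smult polys_over_monom)
        (auto simp: polys_over_def coeff_reflect_poly)
    have cW: "coeff W (degree q) = 1 - of_nat p * coeff q 0"
      by (simp add: W_def coeff_reflect_poly)
    have "coeff q 0 \<in> R" using q by (rule polys_over_coeff)
    note unit = unit[OF this]
    have "degree W \<le> degree q"
      unfolding W_def by (intro degree_diff_le) (auto simp: degree_monom_le degree_reflect_poly_le intro: order.trans[OF degree_smult_le])
    moreover have "degree W \<ge> degree q" using cW unit by (intro le_degree) auto
    ultimately have dW: "degree W = degree q" by simp
    have Wx: "poly W (inverse y) = 0"
      using y(1) y0 by (simp add: W_def Q_def poly_monom poly_reflect_poly_nz power_inverse)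
        (simp add: field_simps)?
    obtain u t where ut: "t \<in> polys_over R" "r = W * u + t" "t = 0 \<or> degree t < degree W"
    proof -
      have "W \<noteq> 0" using cW unit by auto
      moreover have "inverse (lead_coeff W) \<in> R" "r \<in> polys_over R" using cW dW unit r by (auto simp: Q_def)
      ultimately show ?thesis using polys_over_div[OF ring W, of r] that by blast
    qed
    have "Q t (inverse y)" using r ut Wx by (auto simp: Q_def)
    hence "t \<noteq> 0" "(t, inverse y) \<in> N" using y by (auto simp: Q_def N_def)
    with min[of t "inverse y"] ut dW show False by auto
  qed
  with ring pR p show ?thesis by (auto simp: padic_def intro!: exI[of _ R])
qed

section \<open>Arithmetic in V and its maximal ideal\<close>

context padic
begin

lemma p_neq_0 [simp]: "p \<noteq> 0"
  using prime_p by auto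

text \<open>The maximal ideal of V. Zero has its own disjunct because \<open>inverse 0 = 0\<close>
  lies in V.\<close>

definition nonunits :: "complex set" where
  "nonunits = {x \<in> V. x = 0 \<or> inverse x \<notin> V}"

lemma nonunits_V: "x \<in> nonunits \<Longrightarrow> x \<in> V"
  by (simp add: nonunits_def)

lemma one_not_nonunit: "1 \<notin> nonunits"
  using ring_V by (auto simp: nonunits_def)

lemma zero_nonunit: "0 \<in> nonunits"
  using ring_V by (auto simp: nonunits_def)

lemma p_nonunit: "of_nat p \<in> nonunits"
  using ring_V inverse_p by (auto simp: nonunits_def)

lemma inverse_nonunit: "x \<notin> V \<Longrightarrow> inverse x \<in> nonunits"
  using total[of x] by (auto simp: nonunits_def)

lemma nonunits_mult: 
  assumes "x \<in> nonunits" "a \<in> V" 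
  shows "a * x \<in> nonunits"
proof (cases "a = 0 \<or> x = 0")
  case False
  have "inverse (a * x) \<notin> V"
  proof
    assume "inverse (a * x) \<in> V"
    hence "a * inverse (a * x) \<in> V" using assms ring_V by auto
    also have "a * inverse (a * x) = inverse x" using False by (simp add: field_simps)
    finally show False using assms False by (auto simp: nonunits_def)
  qed
  thus ?thesis using assms ring_V by (auto simp: nonunits_def)
qed (use assms ring_V in \<open>auto simp: nonunits_def\<close>)

lemma nonunits_add: 
  assumes "x \<in> nonunits" "y \<in> nonunits"
  shows "x + y \<in> nonunits"
proof -
  have *: "x + y \<in> nonunits" if "x \<in> nonunits" "y \<in> nonunits" "x / y \<in> V" "y \<noteq> 0" for x y
  proof -
    have "(x / y + 1) * y \<in> nonunits" using that ring_V by (intro nonunits_mult) auto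
    thus ?thesis using that by (simp add: field_simps)
  qed
  show ?thesis
  proof (cases "x = 0 \<or> y = 0")
    case False
    hence "x / y \<in> V \<or> y / x \<in> V" using total[of "x / y"] by auto
    thus ?thesis using *[of x y] *[of y x] assms False by (auto simp: add.commute)
  qed (use assms in auto)
qed

lemma nonunits_uminus: "x \<in> nonunits \<Longrightarrow> - x \<in> nonunits"
  using nonunits_mult[of x "-1"] ring_V by auto

lemma nonunits_diff: "x \<in> nonunits \<Longrightarrow> y \<in> nonunits \<Longrightarrow> x - y \<in> nonunits"
  using nonunits_add[of x "- y"] nonunits_uminus by auto

lemma nonunits_prime: "x * y \<in> nonunits \<Longrightarrow> x \<in> V \<Longrightarrow> y \<in> V \<Longrightarrow> x \<in> nonunits \<or> y \<in> nonunits"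
  using ring_V by (auto simp: nonunits_def)

lemma nonunits_power_iff: "x \<in> V \<Longrightarrow> n > 0 \<Longrightarrow> x ^ n \<in> nonunits \<longleftrightarrow> x \<in> nonunits"
proof (induction n)
  case (Suc n)
  have "x * x ^ n \<in> nonunits" if "x \<in> nonunits"
    using nonunits_mult[OF that, of "x ^ n"] Suc.prems ring_V by (auto simp: mult.commute)
  thus ?case using Suc nonunits_prime[of x "x ^ n"] ring_V by (cases "n = 0") auto
qed auto

text \<open>For x \<notin> V, the element x^n of V times the nonunit (1/x)^n would make 1 a
  nonunit.\<close>

lemma V_root: 
  assumes "x ^ n \<in> V" "n > 0" 
  shows "x \<in> V"
proof (rule ccontr)
  assume "x \<notin> V"
  hence "inverse x \<in> nonunits" by (rule inverse_nonunit)
  hence "inverse x ^ n \<in> nonunits" using nonunits_power_iff nonunits_V assms by auto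
  hence "x ^ n * inverse x ^ n \<in> nonunits" using assms by (intro nonunits_mult)
  moreover have "x \<noteq> 0" using \<open>x \<notin> V\<close> ring_V by auto
  ultimately show False using one_not_nonunit by (simp flip: power_mult_distrib)
qed

text \<open>Otherwise u and p are both nonunits, and by Bezout so is 1.\<close>

lemma inverse_of_int_in_V:
  assumes "\<not> int p dvd u"
  shows "inverse (of_int u) \<in> V"
proof (rule ccontr)
  assume *: "inverse (of_int u) \<notin> V"
  have u: "of_int u \<in> nonunits" using inverse_nonunit[OF *] * by simp
  have "algebraic_semidom_class.coprime (int p) u" using assms prime_p by (intro prime_imp_coprime) auto
  then obtain x y where xy: "x * int p + y * u = 1" by (metis GCD.coprime_iff_gcd_eq_1 bezout_int)
  have "of_int x * of_nat p + of_int y * of_int u \<in> nonunits"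
    using u p_nonunit ring_V by (intro nonunits_add nonunits_mult) auto
  also have "of_int x * of_nat p + of_int y * of_int u = (of_int (x * int p + y * u) :: complex)" by simp
  finally show False using one_not_nonunit by (simp add: xy)
qed

text \<open>For x \<notin> V, dividing f(x) = 0 by x^(n-1) with n = deg f expresses the product as a
  polynomial in 1/x \<in> V.\<close>

lemma lead_coeff_mult_root_in_V:
  assumes f: "f \<in> polys_over V" "f \<noteq> 0" "poly f x = 0"
  shows "lead_coeff f * x \<in> V"
proof (cases "x \<in> V")
  case True
  thus ?thesis using ring_V f by (auto simp: polys_over_coeff)
next
  case False
  hence y: "inverse x \<in> V" "x \<noteq> 0" using total[of x] ring_V by auto
  have "poly (reflect_poly f) (inverse x) = 0" using f y by (simp add: poly_reflect_poly_nz)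
  moreover obtain a g where ag: "reflect_poly f = pCons a g" by (cases "reflect_poly f")
  moreover have "a = lead_coeff f" using arg_cong[OF ag, of "\<lambda>q. coeff q 0"] by simp
  ultimately have "lead_coeff f + inverse x * poly g (inverse x) = 0" by simp
  hence "x * (lead_coeff f + inverse x * poly g (inverse x)) = 0" by simp
  hence "x * lead_coeff f + poly g (inverse x) = 0" using y(2) by (simp add: distrib_left flip: mult.assoc)
  hence "lead_coeff f * x = - poly g (inverse x)" by (simp add: eq_neg_iff_add_eq_0 mult.commute)
  moreover have "reflect_poly f \<in> polys_over V"
    using f ring_V by (auto simp: polys_over_def coeff_reflect_poly)
  hence "g \<in> polys_over V" using ring_V by (simp add: ag polys_over_pCons_iff)
  ultimately show ?thesis using poly_polys_over[OF ring_V _ y(1), of g] ring_V by auto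
qed

text \<open>An Archimedean property: the locale does not require V to have rank one, yet the pole of
  an algebraic number is bounded by a power of p. The leading coefficient of the minimal polynomial
  clears the pole, and its part prime to p is a unit.\<close>

lemma algebraic_power_p_mult:
  assumes "x \<in> Qbar"
  shows "\<exists>n. of_nat p ^ n * x \<in> V"
proof -
  define f where "f = min_int_poly x"
  have a: "of_int (lead_coeff f) * x \<in> V"
    using lead_coeff_mult_root_in_V[of "of_int_poly f" x] assms
    by (simp add: f_def polys_over_of_int[OF ring_V] min_int_poly_neq_0 poly_min_int_poly)
  have "lead_coeff f \<noteq> 0" "\<not> is_unit (int p)"
    using min_int_poly_neq_0[OF assms] prime_p by (auto simp: f_def)
  then obtain u where u: "lead_coeff f = int p ^ multiplicity (int p) (lead_coeff f) * u" "\<not> int p dvd u"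
    by (metis multiplicity_decompose')
  define n where "n = multiplicity (int p) (lead_coeff f)"
  have "inverse (of_int u) * (of_int (lead_coeff f) * x) \<in> V"
    using inverse_of_int_in_V[OF u(2)] a ring_V by auto
  also have "of_int (lead_coeff f) = of_nat p ^ n * (of_int u :: complex)"
    by (subst u(1)) (simp add: n_def)
  also have "inverse (of_int u) * (of_nat p ^ n * of_int u * x) = of_nat p ^ n * x"
  proof -
    have "(of_int u :: complex) \<noteq> 0" using u(2) by auto
    thus ?thesis by simp
  qed
  finally show ?thesis by blast
qed

subsection \<open>Unramified fields\<close>

text \<open>Every element of \<open>F\<close> outside \<open>V\<close> has valuation at most that of \<open>1/p\<close>, so that \<open>p\<close> generates
  the maximal ideal of \<open>F \<inter> V\<close>.\<close>

definition unram :: "complex set \<Rightarrow> bool" where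
  "unram F \<longleftrightarrow> is_field F \<and> F \<subseteq> Qbar \<and> (\<forall>y\<in>F. y \<in> V \<or> inverse (of_nat p * y) \<in> V)"

lemma unram_is_field: "unram F \<Longrightarrow> is_field F"
  by (simp add: unram_def)

lemma unram_nonunit:
  assumes "unram F" "y \<in> F" "y \<in> nonunits"
  shows "inverse (of_nat p) * y \<in> V"
proof (cases "y = 0")
  case False
  have "inverse y \<in> F" using assms by (auto simp: unram_def)
  hence "inverse y \<in> V \<or> inverse (of_nat p * inverse y) \<in> V" using assms by (auto simp: unram_def)
  thus ?thesis using assms False by (auto simp: nonunits_def)
qed (use ring_V in auto)

lemma unram_Rats: "unram \<rat>"
  unfolding unram_def
proof (intro conjI ballI is_field_Rats Rats_subset_is_field is_field_Qbar)
  fix y :: complex assume "y \<in> \<rat>"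
  then obtain a b :: int where ab: "b > 0" "algebraic_semidom_class.coprime a b" "y = of_int a / of_int b"
    by (rule Rats_cases')
  show "y \<in> V \<or> inverse (of_nat p * y) \<in> V"
  proof (cases "int p dvd b")
    case False
    thus ?thesis using inverse_of_int_in_V[of b] ring_V by (auto simp: ab(3) divide_inverse)
  next
    case True
    then obtain c where c: "b = int p * c" ..
    have "\<not> is_unit (int p)" using prime_p by auto
    hence "\<not> int p dvd a" using True ab(2) by (meson not_coprimeI)
    from inverse_of_int_in_V[OF this] have "of_int c * inverse (of_int a) \<in> V" using ring_V by auto
    also have "of_int c * inverse (of_int a) = inverse (of_nat p * y)" by (simp add: ab(3) c field_simps)
    finally show ?thesis ..
  qed
qed

text \<open>For n \<ge> 2 the root y is a nonunit, so y/p \<in> V; then p^(n-2) (y/p)^n = 1/p would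
  lie in V.\<close>

lemma unram_no_root:
  assumes "unram F" "y \<in> F" "y ^ n = of_nat p" 
  shows "n < 2"
proof (rule ccontr)
  assume "\<not> n < 2"
  hence n: "n \<ge> 2" by simp
  obtain m where m: "n = Suc (Suc m)" using n by (metis add_2_eq_Suc le_Suc_ex)
  have "y \<in> V" using assms n ring_V by (intro V_root[of y n]) auto
  hence "y \<in> nonunits" using p_nonunit nonunits_power_iff[of y n] assms n by auto
  hence "inverse (of_nat p) * y \<in> V" using assms unram_nonunit by blast
  hence "of_nat p ^ m * (inverse (of_nat p) * y) ^ n \<in> V" using ring_V by auto
  also have "of_nat p ^ m * (inverse (of_nat p) * y) ^ n = inverse (of_nat p)"
    unfolding power_mult_distrib assms by (simp add: m field_simps)
  finally show False using inverse_p by simp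
qed

text \<open>Over the residue field \<open>g\<close> below is the minimal polynomial of \<open>\<theta>\<close>, a simple factor of \<open>f\<close>,
  so that \<open>g(\<theta>)\<close> is \<open>p\<close> times an element of the local ring.\<close>

lemma unram_nonunit_divisible:
  assumes F: "unram F" and \<theta>: "\<theta> \<in> V"
    and f: "f \<in> polys_over (F \<inter> V)" "lead_coeff f = 1" "poly f \<theta> = 0" "poly (pderiv f) \<theta> \<notin> nonunits"
  obtains h where "h \<in> polys_over (F \<inter> V)" "poly h \<theta> \<notin> nonunits"
    "\<And>s. s \<in> polys_over (F \<inter> V) \<Longrightarrow> poly s \<theta> \<in> nonunits \<Longrightarrow>
      \<exists>t\<in>polys_over (F \<inter> V). poly s \<theta> * poly h \<theta> = of_nat p * poly t \<theta>"
proof -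
  define A where "A = F \<inter> V"
  have A: "ring_set A" using F ring_V by (auto simp: A_def ring_set_def unram_def is_field_iff)
  have val: "poly s \<theta> \<in> V" if "s \<in> polys_over A" for s
    using that polys_over_mono[of A V] \<theta> by (intro poly_polys_over ring_V) (auto simp: A_def)
  define M where "M = {g \<in> polys_over A. lead_coeff g = 1 \<and> poly g \<theta> \<in> nonunits}"
  have "f \<in> M" using f zero_nonunit by (auto simp: M_def A_def)
  then obtain g where g: "g \<in> M" and min: "\<And>s. s \<in> M \<Longrightarrow> degree g \<le> degree s"
    using ex_has_least_nat[of "\<lambda>s. s \<in> M" f degree] by blast
  have g': "g \<in> polys_over A" "lead_coeff g = 1" "poly g \<theta> \<in> nonunits" "g \<noteq> 0"
    using g by (auto simp: M_def)
  \<comment> \<open>By minimality of g the leading coefficient of t is a nonunit, since otherwise t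
    could be made monic. It is therefore divisible by p, and removing the leading term keeps the
    value at \<theta> a nonunit.\<close>
  have small: "Polynomial.smult (inverse (of_nat p)) t \<in> polys_over A"
    if "t \<in> polys_over A" "poly t \<theta> \<in> nonunits" "t = 0 \<or> degree t < degree g" for t
    using that
  proof (induction "degree t" arbitrary: t rule: less_induct)
    case less
    show ?case
    proof (cases "t = 0")
      case True
      thus ?thesis using A by (simp add: polys_over_0)
    next
      case False
      define c where "c = lead_coeff t"
      have c: "c \<in> A" "c \<noteq> 0" using less.prems False by (auto simp: c_def polys_over_coeff)
      have "c \<in> nonunits"
      proof (rule ccontr)
        assume "c \<notin> nonunits"
        hence "inverse c \<in> A" using c F by (auto simp: A_def nonunits_def unram_def)
        hence "Polynomial.smult (inverse c) t \<in> M"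
          using A less.prems c nonunits_mult by (auto simp: M_def polys_over_smult c_def A_def)
        from min[OF this] show False using less.prems False c by simp
      qed
      hence cp: "inverse (of_nat p) * c \<in> A"
      proof -
        have "inverse (of_nat p) \<in> F" using unram_is_field[OF F] by auto
        with \<open>c \<in> nonunits\<close> c show ?thesis
          using unram_nonunit[OF F] unram_is_field[OF F] by (auto simp: A_def)
      qed
      define t' where "t' = t - Polynomial.monom c (degree t)"
      have t': "t' \<in> polys_over A" unfolding t'_def using A less.prems c
        by (intro polys_over_diff polys_over_monom) auto
      have "t' = 0 \<or> degree t' < degree t"
        unfolding t'_def by (intro eq_zero_or_degree_less degree_diff_le) (auto simp: degree_monom_le c_def)
      moreover have "poly t' \<theta> \<in> nonunits"
        unfolding t'_def poly_diff poly_monom using less.prems \<open>c \<in> nonunits\<close> \<theta> ring_V nonunits_mult[of c "\<theta> ^ degree t"]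
        by (intro nonunits_diff) (auto simp: mult.commute)
      ultimately have "Polynomial.smult (inverse (of_nat p)) t' \<in> polys_over A"
        using less.hyps[of t'] less.prems t' A by (cases "t' = 0") (auto simp: polys_over_0)
      moreover have "Polynomial.smult (inverse (of_nat p)) t = Polynomial.smult (inverse (of_nat p)) t' +
          Polynomial.monom (inverse (of_nat p) * c) (degree t)"
        by (simp add: t'_def smult_diff_right smult_monom)
      ultimately show ?thesis using A cp by (simp add: polys_over_add polys_over_monom)
    qed
  qed
  have div: "\<exists>q\<in>polys_over A. \<exists>r\<in>polys_over A. s = g * q + Polynomial.smult (of_nat p) r"
    if s: "s \<in> polys_over A" "poly s \<theta> \<in> nonunits" for s
  proof -
    obtain q t where qt: "q \<in> polys_over A" "t \<in> polys_over A" "s = g * q + t" "t = 0 \<or> degree t < degree g"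
      using polys_over_div[OF A g'(1,4) _ s(1)] g'(2) A by auto
    have "poly q \<theta> * poly g \<theta> \<in> nonunits" using g'(3) val qt(1) by (intro nonunits_mult)
    moreover have "poly t \<theta> = poly s \<theta> - poly q \<theta> * poly g \<theta>" by (simp add: qt(3))
    ultimately have "poly t \<theta> \<in> nonunits" using s(2) nonunits_diff by simp
    from small[OF qt(2) this qt(4)] qt show ?thesis
      by (intro bexI[of _ q] bexI[of _ "Polynomial.smult (inverse (of_nat p)) t"]) auto
  qed
  obtain h r where hr: "h \<in> polys_over A" "r \<in> polys_over A" "f = g * h + Polynomial.smult (of_nat p) r"
    using div[of f] f zero_nonunit by (auto simp: A_def)
  have gh: "poly g \<theta> * poly h \<theta> = - (of_nat p * poly r \<theta>)"
    using f(3) by (simp add: hr(3) eq_neg_iff_add_eq_0)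
  have pval: "poly (pderiv s) \<theta> \<in> V" if "s \<in> polys_over A" for s
    using that A by (intro val polys_over_pderiv)
  \<comment> \<open>If h(\<theta>) were a nonunit like g(\<theta>), the product rule for f = g h + p
    r would make f'(\<theta>) a nonunit: \<theta> would be a multiple root over the residue
    field.\<close>
  have "poly h \<theta> \<notin> nonunits"
  proof
    assume "poly h \<theta> \<in> nonunits"
    hence "poly (pderiv h) \<theta> * poly g \<theta> + poly (pderiv g) \<theta> * poly h \<theta> + poly (pderiv r) \<theta> * of_nat p \<in> nonunits"
      using g' hr p_nonunit by (intro nonunits_add nonunits_mult pval)
    also have "poly (pderiv h) \<theta> * poly g \<theta> + poly (pderiv g) \<theta> * poly h \<theta> + poly (pderiv r) \<theta> * of_nat p =
      poly (pderiv f) \<theta>" unfolding hr(3) by (simp add: pderiv_add pderiv_mult pderiv_smult algebra_simps)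
    finally show False using f by blast
  qed
  moreover have "\<exists>t\<in>polys_over A. poly s \<theta> * poly h \<theta> = of_nat p * poly t \<theta>"
    if s: "s \<in> polys_over A" "poly s \<theta> \<in> nonunits" for s
  proof -
    obtain q r' where qr: "q \<in> polys_over A" "r' \<in> polys_over A" "s = g * q + Polynomial.smult (of_nat p) r'"
      using div[OF s] by blast
    have "poly s \<theta> * poly h \<theta> = poly q \<theta> * (poly g \<theta> * poly h \<theta>) + of_nat p * (poly r' \<theta> * poly h \<theta>)"
      by (simp add: qr(3) algebra_simps)
    also have "\<dots> = of_nat p * poly (r' * h - q * r) \<theta>" by (simp add: gh algebra_simps)
    finally show ?thesis using A qr hr by (intro bexI[of _ "r' * h - q * r"]) (auto intro: polys_over_mult polys_over_diff)
  qed
  ultimately show ?thesis using hr(1) that by (auto simp: A_def)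
qed

lemma clear_denominators_V:
  assumes F: "unram F" and q: "q \<in> polys_over F"
  shows "\<exists>n. Polynomial.smult (of_nat p ^ n) q \<in> polys_over (F \<inter> V)"
  using q
proof (induction q)
  case 0
  then show ?case using F ring_V by (auto simp: unram_def polys_over_def)
next
  case (pCons a q)
  have field: "is_field F" "F \<subseteq> Qbar" using F by (auto simp: unram_def)
  have A: "ring_set (F \<inter> V)" using F ring_V by (auto simp: ring_set_def unram_def is_field_iff)
  from pCons field have aq: "a \<in> F" "q \<in> polys_over F" by (auto simp: polys_over_pCons_iff)
  with pCons obtain n where n: "Polynomial.smult (of_nat p ^ n) q \<in> polys_over (F \<inter> V)" by blast
  obtain m where m: "of_nat p ^ m * a \<in> V" using algebraic_power_p_mult aq field by blast
  have 1: "of_nat p ^ (n + m) * a = of_nat p ^ n * (of_nat p ^ m * a)" by (simp add: power_add)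
  have 2: "Polynomial.smult (of_nat p ^ (n + m)) q = Polynomial.smult (of_nat p ^ m) (Polynomial.smult (of_nat p ^ n) q)"
    by (simp add: power_add mult.commute)
  have pow: "of_nat p ^ k \<in> F" "of_nat p ^ k \<in> V" for k using field ring_V by auto
  have "of_nat p ^ (n + m) * a \<in> V" unfolding 1 using m pow ring_V by blast
  moreover have "of_nat p ^ (n + m) * a \<in> F" using pow aq field by blast
  moreover have "Polynomial.smult (of_nat p ^ (n + m)) q \<in> polys_over (F \<inter> V)"
    unfolding 2 using pow by (intro polys_over_smult[OF A _ n]) auto
  ultimately have "of_nat p ^ (n + m) * a \<in> F \<inter> V" "Polynomial.smult (of_nat p ^ (n + m)) q \<in> polys_over (F \<inter> V)"
    by auto
  hence "Polynomial.smult (of_nat p ^ (n + m)) (pCons a q) \<in> polys_over (F \<inter> V)"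
    using A by (simp add: polys_over_pCons_iff)
  thus ?case by blast
qed

text \<open>Each y in the new field is p^(-n) times an element of the ring B below. As long as that
  element is a nonunit, a factor p can be split off. When this stops, y is an integral power of p
  times a unit, so y or 1/(p y) lies in V. It does stop, by \<open>algebraic_power_p_mult\<close>
  for the inverse.\<close>

lemma unram_adjoin:
  assumes F: "unram F" and \<theta>: "\<theta> \<in> V" "\<theta> \<in> Qbar"
    and f: "f \<in> polys_over (F \<inter> V)" "lead_coeff f = 1" "poly f \<theta> = 0" "poly (pderiv f) \<theta> \<notin> nonunits"
  shows "unram ((\<lambda>q. poly q \<theta>) ` polys_over F)"
proof -
  define E where "E = (\<lambda>q. poly q \<theta>) ` polys_over F"
  have field: "is_field F" "F \<subseteq> Qbar" using F by (auto simp: unram_def)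
  have EQ: "E \<subseteq> Qbar"
    using polys_over_mono[OF field(2)] \<theta> is_field_Qbar by (auto simp: E_def intro!: poly_polys_over)
  have "is_field E"
    using ring_set_poly_image[of F \<theta>] field Rats_subset_is_field[of F] EQ
    unfolding E_def by (intro is_field_of_ring_in_Qbar) auto
  obtain h where h: "h \<in> polys_over (F \<inter> V)" "poly h \<theta> \<notin> nonunits"
    and hs: "\<And>s. s \<in> polys_over (F \<inter> V) \<Longrightarrow> poly s \<theta> \<in> nonunits \<Longrightarrow>
      \<exists>t\<in>polys_over (F \<inter> V). poly s \<theta> * poly h \<theta> = of_nat p * poly t \<theta>"
    using unram_nonunit_divisible[OF F \<theta>(1) f] by blast
  define A where "A = F \<inter> V"
  have A: "ring_set A" using F ring_V by (auto simp: A_def ring_set_def unram_def is_field_iff)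
  have val: "poly s \<theta> \<in> V" if "s \<in> polys_over A" for s
    using that polys_over_mono[of A V] \<theta> by (intro poly_polys_over ring_V) (auto simp: A_def)
  define H where "H = poly h \<theta>"
  have H: "H \<noteq> 0" "inverse H \<in> V" using h val[of h] zero_nonunit by (auto simp: H_def A_def nonunits_def)
  define B where "B = {z. \<exists>s\<in>polys_over A. \<exists>n. z = poly s \<theta> * inverse H ^ n}"
  have BV: "z \<in> V" if "z \<in> B" for z
    using that val H ring_V by (auto simp: B_def)
  have step: "inverse (of_nat p) * z \<in> B" if z: "z \<in> B" "z \<in> nonunits" for z
  proof -
    from z obtain s n where s: "s \<in> polys_over A" "z = poly s \<theta> * inverse H ^ n" by (auto simp: B_def)
    have "H ^ n * z \<in> nonunits" using z h val[of h] ring_V by (intro nonunits_mult) (auto simp: H_def A_def)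
    also have "H ^ n * z = poly s \<theta>" using H by (simp add: s field_simps)
    finally obtain t where t: "t \<in> polys_over A" "poly s \<theta> * H = of_nat p * poly t \<theta>"
      using hs[of s] s by (auto simp: A_def H_def)
    have "poly s \<theta> = of_nat p * poly t \<theta> * inverse H" using H(1) t(2) by (simp add: field_simps)
    hence "inverse (of_nat p) * z = poly t \<theta> * inverse H ^ Suc n" by (simp add: s field_simps)
    thus ?thesis unfolding B_def using t(1) by blast
  qed
  have "y \<in> V \<or> inverse (of_nat p * y) \<in> V" if y: "y \<in> E" for y
  proof (rule ccontr)
    assume *: "\<not> (y \<in> V \<or> inverse (of_nat p * y) \<in> V)"
    hence y0: "y \<noteq> 0" using ring_V by auto
    obtain q where q: "q \<in> polys_over F" "y = poly q \<theta>" using y by (auto simp: E_def)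
    obtain n where n: "Polynomial.smult (of_nat p ^ n) q \<in> polys_over A"
      using clear_denominators_V[OF F q(1)] by (auto simp: A_def)
    define z where "z = of_nat p ^ n * y"
    have z: "z \<in> B" unfolding B_def z_def
      by (intro CollectI bexI[OF _ n] exI[of _ 0]) (simp add: q)
    have "inverse (of_nat p) ^ j * z \<in> B" for j
    proof (induction j)
      case (Suc j)
      have "inverse (of_nat p) ^ j * z \<in> nonunits"
      proof (rule ccontr)
        assume "inverse (of_nat p) ^ j * z \<notin> nonunits"
        hence e: "inverse (of_nat p) ^ j * z \<in> V" "inverse (inverse (of_nat p) ^ j * z) \<in> V"
          using BV[OF Suc] by (auto simp: nonunits_def)
        show False
        proof (cases "j \<ge> n")
          case True
          have "of_nat p ^ (j - n) * (inverse (of_nat p) ^ j * z) \<in> V" using e ring_V by auto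
          also have "of_nat p ^ (j - n) * (inverse (of_nat p) ^ j * z) = y"
            using True by (simp add: z_def field_simps flip: power_add)
          finally show False using * by simp
        next
          case False
          have "of_nat p ^ (n - j - 1) * inverse (inverse (of_nat p) ^ j * z) \<in> V" using e ring_V by auto
          also have "of_nat p ^ (n - j - 1) * inverse (inverse (of_nat p) ^ j * z) = inverse (of_nat p * y)"
            using False y0 by (simp add: z_def field_simps flip: power_add power_Suc)
          finally show False using * by simp
        qed
      qed
      from step[OF Suc this] show ?case by (simp add: mult.assoc)
    qed (use z in simp)
    hence all: "inverse (of_nat p) ^ j * z \<in> V" for j using BV by blast
    have "z \<in> Qbar" unfolding z_def using y EQ by (intro ring_set_mult ring_set_power) (auto simp: is_field_Qbar)
    hence "inverse z \<in> Qbar" using is_field_Qbar by blast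
    then obtain k where k: "of_nat p ^ k * inverse z \<in> V" using algebraic_power_p_mult by blast
    have "of_nat p ^ k * inverse z * (inverse (of_nat p) ^ Suc k * z) \<in> V" using k all ring_V by blast
    also have "of_nat p ^ k * inverse z * (inverse (of_nat p) ^ Suc k * z) = inverse (of_nat p)"
      using y0 by (simp add: z_def field_simps)
    finally show False using inverse_p by simp
  qed
  with \<open>is_field E\<close> EQ show ?thesis by (auto simp: unram_def E_def)
qed

text \<open>The defining equation is rational, so conjugates of tame roots are tame roots; this is
  what lets one field F serve all conjugates. The condition on n also excludes n = 0.\<close>

definition tame_roots :: "complex set" where
  "tame_roots = {x. \<exists>n. \<exists>u::int. x ^ n = of_int u \<and> \<not> int p dvd u \<and> \<not> p dvd n}"

lemma tame_roots_Qbar: "tame_roots \<subseteq> Qbar"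
  by (auto simp: tame_roots_def intro!: root_of_int_in_Qbar gr0I)

text \<open>Adjoining a tame root keeps a field unramified, so a maximal unramified field contains them all.\<close>

lemma ex_unram_tame_roots: "\<exists>F. unram F \<and> tame_roots \<subseteq> F"
proof -
  have "\<Union>C \<in> {F. unram F}" if C: "C \<noteq> {}" "subset.chain {F. unram F} C" for C
  proof -
    have field: "is_field R" "R \<subseteq> Qbar" "\<And>y. y \<in> R \<Longrightarrow> y \<in> V \<or> inverse (of_nat p * y) \<in> V" if "R \<in> C" for R
      using that C by (auto simp: unram_def subset_chain_def)
    have "\<exists>R\<in>C. x \<in> R \<and> y \<in> R" if xy: "x \<in> \<Union>C" "y \<in> \<Union>C" for x y
    proof -
      from xy obtain S T where "S \<in> C" "x \<in> S" "T \<in> C" "y \<in> T" by blast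
      moreover from this have "S \<subseteq> T \<or> T \<subseteq> S" using C(2) by (auto simp: subset_chain_def)
      ultimately show ?thesis by blast
    qed
    moreover have "1 \<in> \<Union>C" using C(1) field(1) by auto
    moreover have "x - y \<in> \<Union>C \<and> x * y \<in> \<Union>C" if "R \<in> C" "x \<in> R" "y \<in> R" for x y R
      using that field(1)[OF that(1)] by blast
    ultimately have "ring_set (\<Union>C)" unfolding ring_set_def by meson
    moreover have "inverse x \<in> \<Union>C" if "x \<in> \<Union>C" for x using that field(1) by blast
    ultimately have "is_field (\<Union>C)" unfolding is_field_iff by blast
    moreover have "\<Union>C \<subseteq> Qbar" "\<forall>y\<in>\<Union>C. y \<in> V \<or> inverse (of_nat p * y) \<in> V" using field(2,3) by blast+
    ultimately show ?thesis unfolding unram_def by blast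
  qed
  then obtain F where F: "unram F" and max: "\<And>E. unram E \<Longrightarrow> F \<subseteq> E \<Longrightarrow> E = F"
    using subset_Zorn_nonempty[of "{F. unram F}"] unram_Rats by blast
  have field: "is_field F" "F \<subseteq> Qbar" using F by (auto simp: unram_def)
  have "x \<in> F" if x: "x \<in> tame_roots" for x
  proof -
    from x obtain n u where n: "x ^ n = of_int u" "\<not> int p dvd u" "\<not> p dvd n" by (auto simp: tame_roots_def)
    hence n0: "n > 0" by (auto intro: gr0I)
    have u: "of_int u \<in> V" "of_int u \<notin> nonunits"
      using inverse_of_int_in_V[OF n(2)] n(2) ring_V by (auto simp: nonunits_def)
    have xV: "x \<in> V" using n n0 u V_root[of x n] by auto
    define f where "f = Polynomial.monom 1 n - [:of_int u :: complex:]"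
    have df: "degree f = n"
      unfolding f_def using n0 by (rule degree_monom_minus_const)
    have "unram ((\<lambda>q. poly q x) ` polys_over F)"
    proof (rule unram_adjoin[OF F xV])
      show "x \<in> Qbar" using x tame_roots_Qbar by auto
      have "ring_set (F \<inter> V)" using F ring_V by (auto simp: ring_set_def unram_def is_field_iff)
      thus "f \<in> polys_over (F \<inter> V)" unfolding f_def
        by (intro polys_over_diff polys_over_monom)
          (simp_all add: polys_over_pCons_iff polys_over_0 del: Int_iff)
      show "lead_coeff f = 1" unfolding df using n0 by (simp add: f_def coeff_pCons split: nat.splits)
      show "poly f x = 0" by (simp add: f_def poly_monom n)
      \<comment> \<open>The derivative of Z^n - u at x is n x^(n-1), a product of two units by the
        two divisibility conditions on tame roots.\<close>
      have "of_int (int n) \<notin> nonunits"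
        using inverse_of_int_in_V[of "int n"] n(3) n0 by (auto simp: nonunits_def)
      moreover have "x ^ (n - 1) \<notin> nonunits"
      proof
        assume "x ^ (n - 1) \<in> nonunits"
        hence "x * x ^ (n - 1) \<in> nonunits" using xV by (rule nonunits_mult)
        thus False using n0 n(1) u(2) by (simp add: power_eq_if)
      qed
      ultimately have "of_nat n * x ^ (n - 1) \<notin> nonunits"
        using nonunits_prime[of "of_nat n" "x ^ (n - 1)"] ring_V xV by auto
      thus "poly (pderiv f) x \<notin> nonunits" by (simp add: f_def pderiv_diff pderiv_monom poly_monom pderiv_pCons)
    qed
    with max have "(\<lambda>q. poly q x) ` polys_over F = F" using ring_set_poly_image(2)[of F x] field by auto
    thus "x \<in> F" using ring_set_poly_image(3)[of F x] field by auto
  qed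
  with F show ?thesis by blast
qed

subsection \<open>Square roots of the prime\<close>

text \<open>Valuations on F are integral multiples of that of p, while s has half of it, so x and y
  s cannot cancel. In terms of V: for y \<notin> V, the quotient x/y is - s modulo p, hence a
  nonunit, hence divisible by p. Then s/p = 1/s lies in V, and so does its square 1/p.\<close>

lemma sqrt_split:
  assumes F: "unram F" and s: "s ^ 2 = of_nat p" and xy: "x \<in> F" "y \<in> F" "x + y * s \<in> V"
  shows "x \<in> V" "y \<in> V"
proof -
  have sV: "s \<in> V" using s ring_V by (intro V_root[of s 2]) auto
  have s_nonunit: "s \<in> nonunits" using p_nonunit nonunits_power_iff[of s 2] s sV by auto
  have s0: "s \<noteq> 0" using s by auto
  show y: "y \<in> V"
  proof (rule ccontr)
    assume ny: "y \<notin> V"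
    hence y0: "y \<noteq> 0" using ring_V by auto
    define v where "v = inverse (of_nat p * y)"
    have v: "v \<in> V" using F xy ny by (auto simp: unram_def v_def)
    define z where "z = x / y"
    have z: "z \<in> F" using xy F by (auto simp: z_def unram_def)
    have zeq: "z = of_nat p * (v * (x + y * s)) - s"
    proof -
      have "of_nat p * v = inverse y" by (simp add: v_def)
      moreover have "inverse y * (y * s) = s" using y0 by (simp flip: mult.assoc)
      ultimately show ?thesis by (simp add: z_def divide_inverse distrib_left mult.commute[of x] flip: mult.assoc)
    qed
    have "v * (x + y * s) \<in> V" using v xy ring_V by auto
    hence "z \<in> nonunits"
      unfolding zeq using s_nonunit nonunits_mult[OF p_nonunit]
      by (intro nonunits_diff) (auto simp: mult.commute[of "of_nat p"])
    hence "inverse (of_nat p) * z \<in> V" using unram_nonunit[OF F z] by simp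
    hence "v * (x + y * s) - inverse (of_nat p) * z \<in> V" using \<open>v * (x + y * s) \<in> V\<close> ring_V by auto
    also have "v * (x + y * s) - inverse (of_nat p) * z = s * inverse (of_nat p)"
      unfolding zeq by (simp add: field_simps)
    also have "\<dots> = inverse s" using s0 by (simp flip: s add: power2_eq_square)
    finally have "inverse s * inverse s \<in> V" using ring_V by auto
    moreover have "inverse s * inverse s = inverse (of_nat p)" by (metis s power2_eq_square inverse_mult_distrib)
    ultimately show False using inverse_p by simp
  qed
  have "x + y * s - y * s \<in> V" using xy y sV ring_V by blast
  thus "x \<in> V" by simp
qed

text \<open>Multiplication by \<open>denom x\<close> makes the pair \<open>(1, x)\<close> primitive with respect to \<open>V\<close>.\<close>

definition denom :: "complex \<Rightarrow> complex" where
  "denom x = (if x \<in> V then 1 else inverse x)"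

lemma denom_in_V: "denom x \<in> V" "x * denom x \<in> V"
  using total[of x] ring_V by (cases "x = 0"; auto simp: denom_def)+

lemma denom_diff_in_V: "denom x * denom y * (x - y) \<in> V"
proof -
  have "denom y * (x * denom x) - denom x * (y * denom y) \<in> V"
    using denom_in_V ring_V by blast
  thus ?thesis by (simp add: algebra_simps)
qed

text \<open>For x \<in> V, \<open>sqrt_split\<close> puts a and b into V, so y \<in> V and (x - y)^2
  = 4 b^2 p. Otherwise x and y are both outside V and the product is 1/y - 1/x = 2 b s / (x y).
  Since x y \<in> F, the lemma applies to 1/x = (a - b s) / (x y) and gives b / (x y) \<in>
  V.\<close>

lemma denom_diff_conjugate:
  assumes F: "unram F" and s: "s ^ 2 = of_nat p" and ab: "a \<in> F" "b \<in> F"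
  defines "x \<equiv> a + b * s" and "y \<equiv> a - b * s"
  shows "inverse (of_nat p) * (denom x * denom y * (x - y)) ^ 2 \<in> V"
proof -
  have field: "is_field F" using F by (auto simp: unram_def)
  have sV: "s \<in> V" using s ring_V by (intro V_root[of s 2]) auto
  have iff: "a + b * s \<in> V \<longleftrightarrow> a \<in> V \<and> b \<in> V" if "a \<in> F" "b \<in> F" for a b
    using sqrt_split[OF F s that] sV ring_V by auto
  have "b \<in> V \<longleftrightarrow> - b \<in> V" using ring_V ring_set_uminus[of V b] ring_set_uminus[of V "- b"] by auto
  hence iff': "y \<in> V \<longleftrightarrow> a \<in> V \<and> b \<in> V" using iff[of a "- b"] ab field by (auto simp: y_def)
  show ?thesis
  proof (cases "x \<in> V")
    case True
    hence b: "a \<in> V" "b \<in> V" using iff ab by (auto simp: x_def)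
    have "inverse (of_nat p) * (denom x * denom y * (x - y)) ^ 2 = inverse (of_nat p) * (4 * b ^ 2 * s ^ 2)"
      using True b iff' by (simp add: denom_def x_def y_def power2_eq_square algebra_simps)
    also have "\<dots> = of_nat 4 * b ^ 2" by (simp add: s)
    also have "\<dots> \<in> V" using b ring_V by blast
    finally show ?thesis .
  next
    case False
    hence y: "y \<notin> V" using iff iff' ab by (auto simp: x_def)
    have xy0: "x \<noteq> 0" "y \<noteq> 0" using False y ring_V by auto
    have "x * y = a ^ 2 - b ^ 2 * of_nat p" by (simp add: x_def y_def algebra_simps power2_eq_square flip: s)
    moreover have "a ^ 2 - b ^ 2 * of_nat p \<in> F" using ab field by (intro ring_set_diff ring_set_mult ring_set_power) auto
    ultimately have n: "x * y \<in> F" by simp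
    have "inverse x = a / (x * y) + (- b / (x * y)) * s" using xy0 by (simp add: field_simps) (simp add: x_def y_def algebra_simps)
    moreover have "inverse x \<in> V" using False total by auto
    moreover have "a / (x * y) \<in> F" "- b / (x * y) \<in> F" using n ab field by auto
    ultimately have "- b / (x * y) \<in> V" using iff[of "a / (x * y)" "- b / (x * y)"] by metis
    hence "of_nat 4 * (- b / (x * y)) ^ 2 \<in> V" using ring_V by blast
    also have "of_nat 4 * (- b / (x * y)) ^ 2 = inverse (of_nat p) * (4 * (b / (x * y)) ^ 2 * s ^ 2)"
      by (simp add: s)
    also have "\<dots> = inverse (of_nat p) * (denom x * denom y * (x - y)) ^ 2"
    proof -
      have "x - y = 2 * b * s" by (simp add: x_def y_def)
      moreover have "denom x = inverse x" "denom y = inverse y" using False y by (auto simp: denom_def)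
      ultimately show ?thesis by (simp only:) (simp add: power2_eq_square field_simps)
    qed
    finally show ?thesis .
  qed
qed

text \<open>Gauss's lemma for products of linear factors, where 1 / \<open>denom x\<close> stands
  for max(1, |x|). One factor Z - x is split off at a time: for x \<in> V the coefficients of the
  quotient are recovered from the top, for x \<notin> V those of x times the quotient from the
  bottom.\<close>

lemma denom_prod_in_V:
  assumes "Polynomial.smult c (\<Prod>x\<leftarrow>xs. [:- x, 1:]) \<in> polys_over V"
  shows "c / (\<Prod>x\<leftarrow>xs. denom x) \<in> V"
  using assms
proof (induction xs arbitrary: c)
  case Nil
  thus ?case by (auto simp: polys_over_pCons_iff[OF ring_V])
next
  case (Cons x xs)
  define h where "h = Polynomial.smult c (\<Prod>x\<leftarrow>xs. [:- x, 1:])"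
  define g where "g = pCons 0 h - Polynomial.smult x h"
  have "g = Polynomial.smult c (\<Prod>x\<leftarrow>x # xs. [:- x, 1:])"
    by (simp add: g_def h_def smult_diff_right mult.commute)
  hence g: "g \<in> polys_over V" using Cons.prems by simp
  have g0: "coeff g 0 = - (x * coeff h 0)" and gS: "coeff g (Suc i) = coeff h i - x * coeff h (Suc i)" for i
    by (simp_all add: g_def)
  show ?case
  proof (cases "x \<in> V")
    case True
    have "coeff h i \<in> V" if "i \<le> degree h" for i
      using that
    proof (induction rule: inc_induct)
      case base
      have "coeff h (degree h) = coeff g (Suc (degree h))" by (simp add: gS coeff_eq_0)
      thus ?case using g by (simp add: polys_over_coeff)
    next
      case (step i)
      have "coeff h i = coeff g (Suc i) + x * coeff h (Suc i)" by (simp add: gS)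
      thus ?case using step True g ring_V by (auto simp: polys_over_coeff)
    qed
    moreover have "coeff h i \<in> V" if "i > degree h" for i using that ring_V by (simp add: coeff_eq_0)
    ultimately have "h \<in> polys_over V" unfolding polys_over_def mem_Collect_eq by (meson not_le)
    from Cons.IH[OF this[unfolded h_def]] show ?thesis using True by (simp add: denom_def)
  next
    case False
    hence y: "inverse x \<in> V" "x \<noteq> 0" using total[of x] ring_V by auto
    have "x * coeff h i \<in> V" for i
    proof (induction i)
      case 0
      have "x * coeff h 0 = - coeff g 0" by (simp add: g0)
      thus ?case using g ring_V by (auto simp: polys_over_coeff)
    next
      case (Suc i)
      have "x * coeff h (Suc i) = inverse x * (x * coeff h i) - coeff g (Suc i)" using y by (simp add: gS)
      moreover have "coeff g (Suc i) \<in> V" using g by (rule polys_over_coeff)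
      ultimately show ?case using Suc y ring_V by auto
    qed
    hence "Polynomial.smult x h \<in> polys_over V" by (simp add: polys_over_def)
    hence "Polynomial.smult (x * c) (\<Prod>x\<leftarrow>xs. [:- x, 1:]) \<in> polys_over V" by (simp add: h_def)
    from Cons.IH[OF this] have "x * c / (\<Prod>x\<leftarrow>xs. denom x) \<in> V" .
    also have "x * c / (\<Prod>x\<leftarrow>xs. denom x) = c / (\<Prod>x\<leftarrow>x # xs. denom x)"
      using False y(2) by (simp add: denom_def[of x] divide_inverse)
    finally show ?thesis .
  qed
qed

end

text \<open>Together with \<open>Ints_nonzero_cmod_ge_1\<close> this takes the place of the product
  formula. If p divided the denominator, the numerator would be a unit above p, and x \<in> V would
  yield 1/p \<in> V.\<close>

lemma Rats_in_all_V_imp_Ints: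
  assumes "x \<in> \<rat>" "\<And>p. prime p \<Longrightarrow> \<exists>V. padic p V \<and> x \<in> V"
  shows "x \<in> \<int>"
proof -
  from assms(1) obtain a b :: int where ab: "b > 0" "algebraic_semidom_class.coprime a b" "x = of_int a / of_int b"
    by (rule Rats_cases')
  have "b = 1"
  proof (rule ccontr)
    assume "b \<noteq> 1"
    with ab have "nat b \<noteq> 1" by auto
    then obtain p where p: "prime p" "p dvd nat b" using prime_factor_nat by blast
    then obtain c where c: "b = int p * c" using ab by (metis dvdE int_dvd_int_iff int_nat_eq less_imp_le)
    obtain V where V: "padic p V" "x \<in> V" using assms(2) p by blast
    interpret padic p V by fact
    have "\<not> is_unit (int p)" using p by auto
    hence "\<not> int p dvd a" using ab(2) c by (meson not_coprimeI dvd_triv_left)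
    from inverse_of_int_in_V[OF this] have "of_int c * x * inverse (of_int a) \<in> V" using V ring_V by auto
    also have "of_int c * x * inverse (of_int a) = inverse (of_nat p)"
      using \<open>\<not> int p dvd a\<close> ab(1) by (auto simp: ab(3) c field_simps)
    finally show False using inverse_p by simp
  qed
  thus ?thesis by (simp add: ab)
qed

section \<open>Quadratic extensions\<close>

lemma sqrt_coeffs_zero:
  assumes "is_field F" "s \<notin> F" "a \<in> F" "b \<in> F" "a + b * s = 0"
  shows "a = 0" "b = 0"
proof -
  show b: "b = 0"
  proof (rule ccontr)
    assume "b \<noteq> 0"
    hence "s = - a / b" using assms(5) by (simp add: field_simps add_eq_0_iff2)
    also have "\<dots> \<in> F" using assms by auto
    finally show False using assms by simp
  qed
  show "a = 0" using assms(5) b by simp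
qed

lemma is_field_adjoin_sqrt:
  assumes F: "is_field F" and s: "s ^ 2 \<in> F"
  shows "is_field {a + b * s | a b. a \<in> F \<and> b \<in> F}"
proof (cases "s \<in> F")
  case True
  have "{a + b * s | a b. a \<in> F \<and> b \<in> F} = F"
  proof (intro equalityI subsetI)
    fix x assume "x \<in> F"
    moreover have "x = x + 0 * s" "0 \<in> F" using F by auto
    ultimately show "x \<in> {a + b * s | a b. a \<in> F \<and> b \<in> F}" by blast
  qed (use F True in auto)
  with F show ?thesis by simp
next
  case False
  let ?E = "{a + b * s | a b. a \<in> F \<and> b \<in> F}"
  have I: "x \<in> ?E" if "x = a + b * s" "a \<in> F" "b \<in> F" for x a b using that by blast
  show ?thesis unfolding is_field_iff ring_set_def
  proof (intro conjI ballI)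
    show "1 \<in> ?E" by (rule I[of _ 1 0]) (use F in auto)
    fix x assume "x \<in> ?E"
    then obtain a b where x: "x = a + b * s" "a \<in> F" "b \<in> F" by blast
    show "inverse x \<in> ?E"
    proof (cases "x = 0")
      case True
      show ?thesis by (rule I[of _ 0 0]) (use F True in auto)
    next
      case x0: False
      define n where "n = a ^ 2 - b ^ 2 * s ^ 2"
      have n: "n \<in> F" using F x s unfolding n_def by (intro ring_set_diff ring_set_mult ring_set_power[OF _ x(2)] ring_set_power[OF _ x(3)]) auto
      have nx: "n = x * (a + (- b) * s)" by (simp add: n_def x algebra_simps power2_eq_square)
      have "a + (- b) * s \<noteq> 0"
      proof
        assume "a + (- b) * s = 0"
        moreover have "- b \<in> F" using F x by auto
        ultimately have "a = 0" "- b = 0" using sqrt_coeffs_zero[OF F False x(2)] by blast+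
        with x x0 show False by simp
      qed
      hence "inverse x = (a + (- b) * s) / n" using x0 unfolding nx by (simp add: field_simps)
      also have "\<dots> = a / n + (- b / n) * s" by (simp add: diff_divide_distrib)
      finally show ?thesis by (rule I) (use F x n in auto)
    qed
    fix y assume "y \<in> ?E"
    then obtain c d where y: "y = c + d * s" "c \<in> F" "d \<in> F" by blast
    have "x - y = (a - c) + (b - d) * s" by (simp add: x y algebra_simps)
    thus "x - y \<in> ?E" by (rule I) (use F x y in auto)
    have "x * y = (a * c + b * d * s ^ 2) + (a * d + b * c) * s"
      by (simp add: x y algebra_simps power2_eq_square)
    thus "x * y \<in> ?E" by (rule I) (use F x y s in auto)
  qed
qed

lemma fgen_insert_sqrt:
  assumes s: "s ^ 2 \<in> fgen T"
  shows "fgen (insert s T) = {a + b * s | a b. a \<in> fgen T \<and> b \<in> fgen T}"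
proof
  show "fgen (insert s T) \<subseteq> {a + b * s | a b. a \<in> fgen T \<and> b \<in> fgen T}"
  proof (rule fgen_least)
    show "is_field {a + b * s | a b. a \<in> fgen T \<and> b \<in> fgen T}"
      using s by (intro is_field_adjoin_sqrt) auto
    have "x = x + 0 * s" "s = 0 + 1 * s" for x by auto
    thus "insert s T \<subseteq> {a + b * s | a b. a \<in> fgen T \<and> b \<in> fgen T}"
      using fgen.gen[of _ T] ring_set_0[of "fgen T"] ring_set_1[of "fgen T"] is_field_fgen[of T]
      by (blast dest: is_field_ring_set)
  qed
  have "fgen T \<subseteq> fgen (insert s T)" "s \<in> fgen (insert s T)"
    by (auto intro: fgen_mono[THEN subsetD] fgen.gen)
  thus "{a + b * s | a b. a \<in> fgen T \<and> b \<in> fgen T} \<subseteq> fgen (insert s T)"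
    using is_field_fgen[of "insert s T"] by (auto dest!: is_field_ring_set intro!: ring_set_add ring_set_mult)
qed

text \<open>The values at a + b s and a - b s are tracked together as u + v s and u - v s;
  independence of 1 and s over F then forces u = v = 0.\<close>

lemma poly_sqrt_conjugate:
  assumes F: "is_field F" and s: "s ^ 2 \<in> F" "s \<notin> F" and ab: "a \<in> F" "b \<in> F"
    and f: "f \<in> polys_over F" "poly f (a + b * s) = 0"
  shows "poly f (a - b * s) = 0"
proof -
  have "\<exists>u\<in>F. \<exists>v\<in>F. poly f (a + b * s) = u + v * s \<and> poly f (a - b * s) = u - v * s"
    using f(1)
  proof (induction f)
    case 0
    show ?case by (intro bexI[of _ 0]) (use F in auto)
  next
    case (pCons c f)
    hence c: "c \<in> F" and "f \<in> polys_over F" using F by (auto simp: polys_over_pCons_iff)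
    with pCons obtain u v where uv: "u \<in> F" "v \<in> F" "poly f (a + b * s) = u + v * s" "poly f (a - b * s) = u - v * s"
      by blast
    have "c + a * u + b * v * s ^ 2 \<in> F" "a * v + b * u \<in> F" using F c uv ab s by auto
    thus ?case
      by (intro bexI[of _ "c + a * u + b * v * s ^ 2"] bexI[of _ "a * v + b * u"])
        (auto simp: uv algebra_simps power2_eq_square)
  qed
  then obtain u v where uv: "u \<in> F" "v \<in> F" "poly f (a + b * s) = u + v * s" "poly f (a - b * s) = u - v * s"
    by blast
  with f sqrt_coeffs_zero[OF F s(2) uv(1,2)] show ?thesis by simp
qed

section \<open>The lower bound for the height\<close>

lemma mahler_measure_poly_power: "mahler_measure_poly (f ^ k) = mahler_measure_poly f ^ k"
proof (induction k)
  case 0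
  show ?case by (metis mahler_measure_constant norm_one one_pCons power_0)
qed (simp add: measure_eq_prod)

lemma Ints_nonzero_cmod_ge_1: "(x :: complex) \<in> \<int> \<Longrightarrow> x \<noteq> 0 \<Longrightarrow> cmod x \<ge> 1"
  by (auto elim!: Ints_cases)

lemma prod_list_mono_real:
  "(\<And>x. x \<in> set xs \<Longrightarrow> 0 \<le> f x \<and> f x \<le> (g x :: real)) \<Longrightarrow> (\<Prod>x\<leftarrow>xs. f x) \<le> (\<Prod>x\<leftarrow>xs. g x)"
proof (induction xs)
  case (Cons a xs)
  have "0 \<le> f a" "f a \<le> g a" "0 \<le> g a" using Cons.prems[of a] by auto
  moreover have "(\<Prod>x\<leftarrow>xs. f x) \<le> (\<Prod>x\<leftarrow>xs. g x)" "0 \<le> (\<Prod>x\<leftarrow>xs. f x)"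
    using Cons by (auto intro!: prod_list_nonneg)
  ultimately show ?case by (simp add: mult_mono)
qed simp

lemma prod_list_power: "(\<Prod>x\<leftarrow>xs. f x ^ n) = (\<Prod>x\<leftarrow>xs. f x :: 'a :: comm_monoid_mult) ^ n"
  by (induction xs) (auto simp: power_mult_distrib)

text \<open>The counterpart of \<open>denom_diff_in_V\<close> for the complex absolute value. Its
  constant 2, squared, becomes the ln 4 of the height bound.\<close>

lemma norm_diff_le_max: "norm (x - y :: complex) \<le> 2 * max 1 (norm x) * max 1 (norm y)"
proof -
  have "norm (x - y) \<le> norm x + norm y" by (rule norm_triangle_ineq4)
  moreover have "norm x \<le> max 1 (norm x) * max 1 (norm y)"
    using mult_mono[of "norm x" "max 1 (norm x)" 1 "max 1 (norm y)"] by auto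
  moreover have "norm y \<le> max 1 (norm x) * max 1 (norm y)"
    using mult_mono[of 1 "max 1 (norm x)" "norm y" "max 1 (norm y)"] by auto
  ultimately show ?thesis by linarith
qed

text \<open>All conjugates of \<open>x = a + b \<surd>p\<close> are of the form \<open>a\<^sub>y + b\<^sub>y s\<^sub>y\<close> with \<open>s\<^sub>y\<^sup>2 = p\<close> and
  \<open>a\<^sub>y\<close>, \<open>b\<^sub>y\<close> unramified at \<open>p\<close>. The product of the squared differences
  \<open>(2 b\<^sub>y s\<^sub>y)\<^sup>2\<close>, made integral by a power of the leading coefficient, is then a nonzero integer
  divisible by \<open>p ^ d\<close>.\<close>

lemma height_lower_bound:
  assumes p: "prime p" and T: "T \<subseteq> padic.tame_roots p" and s: "s ^ 2 = of_nat p"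
    and x: "x \<in> fgen (insert s T)" "x \<notin> fgen T"
  shows "ln p - ln 4 \<le> 4 * weil_height x"
proof -
  from x(1) obtain a b where ab: "a \<in> fgen T" "b \<in> fgen T" "x = a + b * s"
    using fgen_insert_sqrt[of s T] s by auto
  have b0: "b \<noteq> 0" using x ab by auto
  obtain Ta Tb where "finite Ta" "Ta \<subseteq> T" "a \<in> fgen Ta" "finite Tb" "Tb \<subseteq> T" "b \<in> fgen Tb"
    using fgen_finite_support[OF ab(1)] fgen_finite_support[OF ab(2)] by blast
  moreover define T' where "T' = Ta \<union> Tb"
  ultimately have T': "finite T'" "T' \<subseteq> T" "a \<in> fgen T'" "b \<in> fgen T'"
    using fgen_mono[of Ta T'] fgen_mono[of Tb T'] by auto
  obtain V0 where "padic p V0" using ex_padic[OF p] by blast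
  then interpret V0: padic p V0 .
  have sQ: "s \<in> Qbar" using root_of_int_in_Qbar[of s 2 "int p"] s by simp
  have "insert s T' \<subseteq> Qbar" using T' T V0.tame_roots_Qbar sQ by blast
  \<comment> \<open>With a, b and s written as rational polynomials in one g, conjugating all three
    at once is evaluation at another root y of its minimal polynomial m.\<close>
  then obtain g where g: "g \<in> Qbar" "insert s T' \<subseteq> fgen {g}"
    using primitive_element_finite[of "insert s T'"] T' by auto
  have "fgen T' \<subseteq> fgen {g}" using g by (intro fgen_least) auto
  hence "a \<in> fgen {g}" "b \<in> fgen {g}" "s \<in> fgen {g}" using g T' by auto
  from this[THEN fgen_singleton[OF g(1)]] obtain A B S where
    A: "A \<in> polys_over \<rat>" "a = poly A g" and B: "B \<in> polys_over \<rat>" "b = poly B g"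
    and S: "S \<in> polys_over \<rat>" "s = poly S g" by auto
  define P where "P = A + B * S"
  define P' where "P' = A - B * S"
  have P: "P \<in> polys_over \<rat>" "P' \<in> polys_over \<rat>" unfolding P_def P'_def
    using A B S by (auto intro!: polys_over_add polys_over_diff polys_over_mult)
  have "fgen (insert s T) \<subseteq> Qbar" using T V0.tame_roots_Qbar sQ by (intro fgen_in_Qbar) auto
  with x(1) have xQ: "x \<in> Qbar" by blast
  define f where "f = min_int_poly x"
  note f = min_int_poly_neq_0[OF xQ, folded f_def] poly_min_int_poly[OF xQ, folded f_def]
    lead_coeff_min_int_poly[OF xQ, folded f_def] degree_min_int_poly_pos[OF xQ, folded f_def]
  define m where "m = min_int_poly g"
  define ys where "ys = complex_roots_int m"
  define d where "d = degree m"
  have ys: "poly (of_int_poly m) y = 0" if "y \<in> set ys" for y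
    using that min_int_poly_neq_0[OF g(1)] by (auto simp: ys_def m_def complex_roots_int_def set_complex_roots)
  have len: "length ys = d" by (simp add: ys_def d_def complex_roots_int_def)
  have d0: "d > 0" unfolding d_def m_def by (rule degree_min_int_poly_pos[OF g(1)])
  note conj = poly_conjugate_eq[OF g(1), folded m_def]
  have s_conj: "poly S y ^ 2 = of_nat p" if "poly (of_int_poly m) y = 0" for y
    using conj[OF that, of "S ^ 2" "[:of_nat p:]"] S s
    by (auto simp: polys_over_power polys_over_pCons_iff polys_over_0)
  \<comment> \<open>The conjugate of a tame root solves the same equation, so the conjugates of a
    and b stay in every unramified F containing the tame roots.\<close>
  have unram_conj: "poly A y \<in> F" "poly B y \<in> F"
    if F: "padic.unram p V F" "padic.tame_roots p \<subseteq> F" and V: "padic p V"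
      and y: "poly (of_int_poly m) y = 0" for F V y
  proof -
    interpret V: padic p V by (rule V)
    have field: "is_field F" using F by (simp add: V.unram_def)
    have roots: "poly q y \<in> F" if q: "q \<in> polys_over \<rat>" "poly q g \<in> T'" for q
    proof -
      have "poly q g \<in> V.tame_roots" using q T' T by auto
      then obtain n u where nu: "poly q g ^ n = of_int u" "\<not> int p dvd u" "\<not> p dvd n"
        by (auto simp: V.tame_roots_def)
      have "poly (q ^ n) y = poly [:of_int u:] y" using q nu(1)
        by (intro conj[OF y]) (auto simp: polys_over_power polys_over_pCons_iff polys_over_0)
      hence "poly q y \<in> V.tame_roots" using nu(2,3) by (auto simp: V.tame_roots_def)
      with F show ?thesis by auto
    qed
    have "T' \<subseteq> fgen {g}" using g by auto
    note * = conjugate_fgen[OF g(1) y[unfolded m_def] field this]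
    show "poly A y \<in> F" by (rule *[OF _ T'(3) A]) (rule roots)
    show "poly B y \<in> F" by (rule *[OF _ T'(4) B]) (rule roots)
  qed
  have fx: "poly (of_int_poly f) (poly P g) = 0" using f A B S ab(3) by (simp add: P_def)
  \<comment> \<open>F contains a and b but no square root of p, so f, which vanishes at a + b s,
    also vanishes at a - b s.\<close>
  have fx': "poly (of_int_poly f) (poly P' g) = 0"
  proof -
    obtain F where F: "V0.unram F" "V0.tame_roots \<subseteq> F" using V0.ex_unram_tame_roots by blast
    have field: "is_field F" using F by (simp add: V0.unram_def)
    have "fgen T \<subseteq> F" using T F field by (intro fgen_least) auto
    moreover have "s \<notin> F" using V0.unram_no_root[OF F(1) _ s] by auto
    ultimately show ?thesis
      using poly_sqrt_conjugate[OF field, of s a b "of_int_poly f"] fx ab A B S s field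
      by (auto simp: P_def P'_def intro!: polys_over_of_int)
  qed
  have f_conj: "poly (of_int_poly f) (poly q y) = 0"
    if "poly (of_int_poly m) y = 0" "q \<in> polys_over \<rat>" "poly (of_int_poly f) (poly q g) = 0" for y q
  proof -
    have "pcompose (of_int_poly f) q \<in> polys_over \<rat>"
      using that(2) by (intro polys_over_pcompose polys_over_of_int) auto
    from poly_conjugate_zero[OF g(1), folded m_def, OF that(1) this] that(3)
    show ?thesis by (simp add: poly_pcompose)
  qed
  define l where "l = (of_int (lead_coeff f) :: complex)"
  obtain k where k: "d = k * degree f" "Polynomial.smult (l ^ k) (\<Prod>y\<leftarrow>ys. [:- poly P y, 1:]) = of_int_poly f ^ k"
    using char_poly_power[OF g(1) P(1) xQ, folded m_def f_def ys_def d_def] f_conj[OF _ P(1) fx]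
    unfolding l_def by blast
  obtain k' where k': "d = k' * degree f" "Polynomial.smult (l ^ k') (\<Prod>y\<leftarrow>ys. [:- poly P' y, 1:]) = of_int_poly f ^ k'"
    using char_poly_power[OF g(1) P(2) xQ, folded m_def f_def ys_def d_def] f_conj[OF _ P(2) fx']
    unfolding l_def by blast
  have [simp]: "k' = k" using k(1) k'(1) f(4) by simp
  have k0: "k > 0" using d0 k(1) by (auto intro: gr0I)
  define R where "R = (P - P') ^ 2"
  \<comment> \<open>Each factor l^k supplies the denominators of one of the families P(y) and P'(y);
    squaring the differences doubles both, which gives four.\<close>
  define t where "t = l ^ k * l ^ k * (l ^ k * l ^ k) * (\<Prod>y\<leftarrow>ys. poly R y)"
  have R: "R \<in> polys_over \<rat>" unfolding R_def using P by (auto intro!: polys_over_power polys_over_diff)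
  have lpos: "l \<noteq> 0" "l \<in> \<rat>" using f by (auto simp: l_def)
  have "(\<Prod>y\<leftarrow>ys. poly R y) \<in> \<rat>"
    unfolding ys_def complex_roots_int_def by (intro prod_roots_in_field is_field_Rats polys_over_of_int R) auto
  hence tQ: "t \<in> \<rat>" unfolding t_def using lpos by (intro Rats_mult Rats_power) auto
  \<comment> \<open>Conjugacy is symmetric, so b = B(g) would vanish if B(y) did.\<close>
  have "poly R y \<noteq> 0" if y: "y \<in> set ys" for y
  proof -
    have "poly B y \<noteq> 0"
    proof
      assume *: "poly B y = 0"
      have "y \<in> Qbar" "min_int_poly y = m" using min_int_poly_conjugate[OF g(1), of y] ys[OF y] by (auto simp: m_def)
      moreover have "poly (of_int_poly m) g = 0" using poly_min_int_poly[OF g(1)] by (simp add: m_def)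
      ultimately have "poly B g = 0" using poly_conjugate_zero[of y g B] * B by simp
      with b0 B show False by simp
    qed
    moreover have "poly S y \<noteq> 0" using s_conj[OF ys[OF y]] by auto
    ultimately show ?thesis by (simp add: R_def P_def P'_def)
  qed
  hence t0: "t \<noteq> 0" using lpos by (auto simp: t_def prod_list_zero_iff)
  define z where "z = t * inverse (of_nat p) ^ d"
  have "z \<in> \<int>"
  proof (rule Rats_in_all_V_imp_Ints)
    show "z \<in> \<rat>" unfolding z_def using tQ by (intro Rats_mult Rats_power Rats_inverse) auto
    fix q :: nat assume q: "prime q"
    obtain V where V: "padic q V" using ex_padic[OF q] by blast
    interpret V: padic q V by (rule V)
    have fV: "of_int_poly f ^ k \<in> polys_over V"
      using V.ring_V by (intro polys_over_power polys_over_of_int)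
    define c where "c = l ^ k / (\<Prod>y\<leftarrow>ys. V.denom (poly P y))"
    define c' where "c' = l ^ k / (\<Prod>y\<leftarrow>ys. V.denom (poly P' y))"
    have c: "c \<in> V" "c' \<in> V"
      using V.denom_prod_in_V[of "l ^ k" "map (poly P) ys"] V.denom_prod_in_V[of "l ^ k" "map (poly P') ys"]
        fV k(2) k'(2) by (simp_all add: c_def c'_def o_def)
    have "0 \<noteq> V.denom w" for w using V.ring_V by (auto simp: V.denom_def)
    hence dn: "(\<Prod>y\<leftarrow>ys. V.denom (poly q y)) \<noteq> 0" for q by (auto simp: prod_list_zero_iff)
    define w where "w = (\<lambda>y. V.denom (poly P y) * V.denom (poly P' y) * (poly P y - poly P' y))"
    have cl: "l ^ k = c * (\<Prod>y\<leftarrow>ys. V.denom (poly P y))" "l ^ k = c' * (\<Prod>y\<leftarrow>ys. V.denom (poly P' y))"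
      unfolding c_def c'_def using dn by simp_all
    have "inverse (of_nat p) ^ d = (\<Prod>y\<leftarrow>ys. inverse (of_nat p :: complex))"
      by (simp add: prod_list_const len)
    moreover have "l ^ k * l ^ k * (l ^ k * l ^ k) =
      (c * c') ^ 2 * (\<Prod>y\<leftarrow>ys. (V.denom (poly P y) * V.denom (poly P' y)) ^ 2)"
      unfolding prod_list_power prod_list_mult
      by (subst (1 3) cl(1), subst (1 2) cl(2)) (simp add: power2_eq_square ac_simps)
    ultimately have "z = (c * c') ^ 2 * (\<Prod>y\<leftarrow>ys. inverse (of_nat p) * w y ^ 2)"
      by (simp add: z_def t_def w_def R_def prod_list_mult power_mult_distrib ac_simps)
    \<comment> \<open>Above p, the factor 1/p is absorbed by \<open>denom_diff_conjugate\<close>;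
      above any other prime it lies in V itself.\<close>
    moreover have "inverse (of_nat p) * w y ^ 2 \<in> V" if y: "y \<in> set ys" for y
    proof (cases "q = p")
      case True
      interpret Vp: padic p V using V True by simp
      obtain F where F: "Vp.unram F" "Vp.tame_roots \<subseteq> F" using Vp.ex_unram_tame_roots by blast
      note AB = unram_conj[OF F _ ys[OF y]]
      have "padic p V" using V True by simp
      from Vp.denom_diff_conjugate[OF F(1) s_conj[OF ys[OF y]] AB[OF this]] True
      show ?thesis by (simp add: w_def P_def P'_def)
    next
      case False
      hence "\<not> int q dvd int p" using primes_dvd_imp_eq[OF q p] by auto
      hence "inverse (of_nat p) \<in> V" using V.inverse_of_int_in_V[of "int p"] by simp
      thus ?thesis unfolding w_def using V.denom_diff_in_V V.ring_V by blast
    qed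
    hence "(\<Prod>y\<leftarrow>ys. inverse (of_nat p) * w y ^ 2) \<in> V" by (rule ring_set_prod_list[OF V.ring_V])
    moreover have "(c * c') ^ 2 \<in> V" using c V.ring_V by blast
    ultimately have "z \<in> V" using V.ring_V by auto
    with V show "\<exists>V. padic q V \<and> z \<in> V" by blast
  qed
  moreover have "z \<noteq> 0" using t0 p by (auto simp: z_def)
  ultimately have "cmod z \<ge> 1" by (rule Ints_nonzero_cmod_ge_1)
  hence "real p ^ d \<le> cmod t"
    using p prime_gt_0_nat[OF p] by (simp add: z_def norm_divide norm_mult norm_power norm_inverse field_simps)
  also have "cmod t \<le> 4 ^ d * (mahler_measure f ^ k) ^ 4"
  proof -
    \<comment> \<open>By multiplicativity M(f)^k is the Mahler measure of either characteristic
      polynomial. Two of them, squared, give the exponent 4.\<close>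
    have M: "mahler_measure f ^ k = cmod (l ^ k) * (\<Prod>y\<leftarrow>ys. max 1 (cmod (poly q y)))"
      if "Polynomial.smult (l ^ k) (\<Prod>y\<leftarrow>ys. [:- poly q y, 1:]) = of_int_poly f ^ k" for q
      using mahler_measure_poly_explicit[of "l ^ k" "map (poly q) ys"] that
      by (simp add: mahler_measure_def mahler_measure_poly_power o_def)
    have M1: "mahler_measure f ^ k = cmod (l ^ k) * (\<Prod>y\<leftarrow>ys. max 1 (cmod (poly P y)))"
      and M2: "mahler_measure f ^ k = cmod (l ^ k) * (\<Prod>y\<leftarrow>ys. max 1 (cmod (poly P' y)))"
      using M[OF k(2)] M[OF k'(2)[unfolded \<open>k' = k\<close>]] by simp_all
    have "cmod t = cmod (l ^ k) ^ 4 * (\<Prod>y\<leftarrow>ys. cmod (poly P y - poly P' y) ^ 2)"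
      by (simp add: t_def R_def norm_mult norm_power power2_eq_square power4_eq_xxxx)
    also have "\<dots> \<le> cmod (l ^ k) ^ 4 *
      (\<Prod>y\<leftarrow>ys. (2 * max 1 (cmod (poly P y)) * max 1 (cmod (poly P' y))) ^ 2)"
      by (intro mult_left_mono prod_list_mono_real conjI power_mono norm_diff_le_max) auto
    also have "\<dots> = 4 ^ d * ((cmod (l ^ k) * (\<Prod>y\<leftarrow>ys. max 1 (cmod (poly P y)))) *
        (cmod (l ^ k) * (\<Prod>y\<leftarrow>ys. max 1 (cmod (poly P' y))))) ^ 2"
      unfolding prod_list_power prod_list_mult prod_list_const len
      by (simp add: power_mult_distrib power2_eq_square power4_eq_xxxx ac_simps flip: power_mult_distrib)
    also have "\<dots> = 4 ^ d * (mahler_measure f ^ k) ^ 4"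
      unfolding M1[symmetric] M2[symmetric] by (simp add: power2_eq_square power4_eq_xxxx)
    finally show ?thesis .
  qed
  finally have le: "real p ^ d \<le> 4 ^ d * (mahler_measure f ^ k) ^ 4" .
  have M0: "mahler_measure f > 0" using mahler_measure_poly_ge_1[OF f(1)] by linarith
  have "ln (real p ^ d) \<le> ln (4 ^ d * (mahler_measure f ^ k) ^ 4)"
    using le prime_gt_0_nat[OF p] by (intro ln_mono) auto
  with M0 have "d * ln p \<le> d * ln 4 + 4 * (k * ln (mahler_measure f))"
    using prime_gt_0_nat[OF p] by (simp add: ln_mult ln_realpow)
  also have "ln (mahler_measure f) = degree f * weil_height x"
    using f(4) by (simp add: weil_height_def f_def)
  finally have "d * ln p \<le> d * ln 4 + 4 * (d * weil_height x)" by (simp add: k(1) mult.assoc)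
  hence "d * (ln p - ln 4) \<le> d * (4 * weil_height x)" by (simp add: algebra_simps)
  thus ?thesis using d0 by simp
qed

section \<open>Roots of integers\<close>

text \<open>All roots of \<open>Z\<^sup>n - c\<close> have the same absolute value, so its irreducibility is not needed.\<close>

lemma
  fixes c :: nat
  assumes x: "x ^ n = of_nat c" and n: "n > 0" and c: "c > 1"
  shows weil_height_root: "weil_height x = ln c / n"
    and degree_min_int_poly_root: "2 ^ n \<le> c ^ degree (min_int_poly x)"
proof -
  have xQ: "x \<in> Qbar" using root_of_int_in_Qbar[of x n "int c"] x n by simp
  define f where "f = min_int_poly x"
  note f = min_int_poly_neq_0[OF xQ, folded f_def] poly_min_int_poly[OF xQ, folded f_def]
    lead_coeff_min_int_poly[OF xQ, folded f_def] degree_min_int_poly_pos[OF xQ, folded f_def]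
  define zs where "zs = complex_roots_int f"
  have zs: "poly (of_int_poly f) z = 0" if "z \<in> set zs" for z
    using that f(1) by (auto simp: zs_def complex_roots_int_def set_complex_roots)
  have len: "length zs = degree f" by (simp add: zs_def complex_roots_int_def)
  define h where "h = (Polynomial.monom 1 n - [:int c:])"
  have h: "of_int_poly h = (Polynomial.monom 1 n - [:of_nat c :: complex:])"
    by (simp add: h_def of_int_poly_hom.hom_minus map_poly_monom of_int_hom.map_poly_pCons_hom)
  have "f dvd h" unfolding f_def using xQ by (rule min_int_poly_dvd) (simp add: h poly_monom x)
  then obtain g where g: "h = f * g" ..
  have lh: "lead_coeff h = 1"
  proof -
    have "degree (of_int_poly h :: complex poly) = n" unfolding h using n by (rule degree_monom_minus_const)
    hence "degree h = n" by simp
    thus ?thesis using n by (simp add: h_def coeff_pCons split: nat.splits)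
  qed
  have "lead_coeff f = 1"
    using lh f(3) unfolding g lead_coeff_mult by (metis zmult_eq_1_iff not_numeral_less_zero less_minus_one_simps(1) less_irrefl order.strict_trans)
  have pow: "z ^ n = of_nat c" if "z \<in> set zs" for z
  proof -
    have "poly (of_int_poly h) z = 0" using zs[OF that] by (simp add: g of_int_poly_hom.hom_mult)
    thus ?thesis by (simp add: h poly_monom)
  qed
  have norm: "cmod z ^ n = c" if "z \<in> set zs" for z
    using arg_cong[OF pow[OF that], of cmod] by (simp add: norm_power)
  have "max 1 (cmod z) = cmod z" if "z \<in> set zs" for z
    using norm[OF that] c power_le_one[of "cmod z" n] by (cases "cmod z \<le> 1") auto
  hence "(\<Prod>z\<leftarrow>zs. max 1 (cmod z)) = (\<Prod>z\<leftarrow>zs. cmod z)"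
    by (intro arg_cong[of _ _ prod_list] map_cong) auto
  hence M: "mahler_measure f = (\<Prod>z\<leftarrow>zs. cmod z)"
    using \<open>lead_coeff f = 1\<close> by (simp add: mahler_measure_def mahler_measure_poly_def zs_def complex_roots_int_def)
  have "mahler_measure f ^ n = (\<Prod>z\<leftarrow>zs. cmod z ^ n)" by (simp only: M prod_list_power)
  also have "\<dots> = (\<Prod>z\<leftarrow>zs. real c)"
    by (intro arg_cong[of _ _ prod_list] map_cong refl) (rule norm)
  finally have Mn: "mahler_measure f ^ n = real c ^ degree f" by (simp add: prod_list_const len)
  have "mahler_measure f > 0" using mahler_measure_poly_ge_1[OF f(1)] by linarith
  with arg_cong[OF Mn, of ln] c have "n * ln (mahler_measure f) = degree f * ln c" by (simp add: ln_realpow)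
  thus "weil_height x = ln c / n" using n f(4) by (simp add: weil_height_def f_def[symmetric] field_simps)
  \<comment> \<open>f is monic and its roots have absolute value above 1, so its Mahler measure is
    the absolute value of its constant coefficient: an integer different from 1, hence at least 2.
    With M(f)^n = c^(deg f) this bounds the degree from below.\<close>
  have "of_int (coeff f 0) = poly (of_int_poly f) (0 :: complex)" by (simp add: poly_0_coeff_0)
  also have "\<dots> = (\<Prod>z\<leftarrow>zs. - z)"
    using \<open>lead_coeff f = 1\<close> by (simp add: poly_complex_roots zs_def complex_roots_int_def)
  finally have "cmod (of_int (coeff f 0)) = (\<Prod>z\<leftarrow>zs. cmod z)" by simp
  hence Mi: "mahler_measure f = of_int \<bar>coeff f 0\<bar>" by (simp add: M)
  have "mahler_measure f \<noteq> 1"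
  proof
    assume "mahler_measure f = 1"
    moreover have "real c ^ degree f > 1" using c f(4) by (intro one_less_power) auto
    ultimately show False using Mn by simp
  qed
  with mahler_measure_poly_ge_1[OF f(1)] have "mahler_measure f > 1" by simp
  hence "\<bar>coeff f 0\<bar> \<ge> 2" unfolding Mi of_int_1_less_iff by simp
  hence "mahler_measure f \<ge> 2" unfolding Mi by linarith
  hence "2 ^ n \<le> mahler_measure f ^ n" by (intro power_mono) auto
  hence "real (2 ^ n) \<le> real (c ^ degree f)" by (simp add: Mn)
  thus "2 ^ n \<le> c ^ degree (min_int_poly x)" unfolding f_def of_nat_le_iff .
qed

lemma ex_small_ln_div_power: "\<epsilon> > 0 \<Longrightarrow> \<exists>n. ln (real c) / real (3 ^ n) < \<epsilon>" for \<epsilon> :: real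
proof -
  assume e: "\<epsilon> > 0"
  obtain n where "ln (real c) / \<epsilon> < 3 ^ n" using real_arch_pow[of 3 "ln (real c) / \<epsilon>"] by auto
  thus ?thesis using e by (intro exI[of _ n]) (simp add: field_simps)
qed

text \<open>Such x have height ln c / (3^n m), which tends to 0. The factor m admits elements \<i>
  x, which need an exponent divisible by 4, and \<open>n0\<close> skips small n whose roots lie in
  K.\<close>

lemma not_bogomolov_extI:
  fixes c :: nat
  assumes c: "c > 1" and n0: "\<And>n. n \<ge> n0 \<Longrightarrow> \<exists>x. x \<in> L - K \<and> x ^ (3 ^ n * m) = of_nat c" and m: "m > 0"
  shows "\<not> bogomolov_ext L K"
proof
  assume "bogomolov_ext L K"
  then obtain \<epsilon> where e: "\<epsilon> > 0" and
    *: "\<And>x. x \<in> L \<Longrightarrow> x \<noteq> 0 \<Longrightarrow> 0 < weil_height x \<Longrightarrow> weil_height x < \<epsilon> \<Longrightarrow> x \<in> K"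
    by (auto simp: bogomolov_ext_def)
  obtain n where "ln (real c) / real (3 ^ n) < \<epsilon>" using ex_small_ln_div_power[OF e] by blast
  moreover have "ln (real c) / real (3 ^ (n + n0) * m) \<le> ln (real c) / real (3 ^ n)"
  proof (rule divide_left_mono)
    have "3 ^ n * 1 \<le> 3 ^ (n + n0) * m" using m by (intro mult_mono) (auto simp: power_add)
    thus "real (3 ^ n) \<le> real (3 ^ (n + n0) * m)" by (simp only: of_nat_le_iff)
  qed (use c m in auto)
  moreover obtain x where x: "x \<in> L - K" "x ^ (3 ^ (n + n0) * m) = of_nat c" using n0[of "n + n0"] by auto
  moreover have "weil_height x = ln (real c) / real (3 ^ (n + n0) * m)"
    using x(2) m c by (intro weil_height_root) auto
  moreover have "ln (real c) / real (3 ^ (n + n0) * m) > 0" using c m by (intro divide_pos_pos) auto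
  moreover have "x \<noteq> 0" using x(2) c m by (auto simp: power_0_left)
  ultimately show False using *[of x] by auto
qed

text \<open>Property (B) is the relative property over the empty set.\<close>

lemma not_bogomolovI:
  assumes "\<And>n. \<exists>x\<in>K. x ^ 3 ^ n = 2"
  shows "\<not> bogomolov K"
proof -
  have "\<exists>x. x \<in> K - {} \<and> x ^ (3 ^ n * 1) = of_nat 2" for n using assms[of n] by auto
  hence "\<not> bogomolov_ext K {}" by (intro not_bogomolov_extI[of 2 0 K "{}" 1]) auto
  thus ?thesis by (auto simp: bogomolov_def bogomolov_ext_def)
qed

section \<open>Finite and infinite extensions\<close>

lemma finite_ext_sqrt:
  assumes K: "is_field K" and L: "L = {a + b * s | a b. a \<in> K \<and> b \<in> K}"
  shows "finite_ext L K"
proof -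
  interpret C: Ring.field complex_field by (rule field_from_type_algebra)
  have mem: "z \<in> C.line_extension K u E \<longleftrightarrow> (\<exists>k\<in>K. \<exists>v\<in>E. z = k * u + v)" for z u E
    by (simp add: C.line_extension_mem_iff complex_field_simps)
  have 1: "v \<in> C.line_extension K s {0} \<longleftrightarrow> (\<exists>b\<in>K. v = b * s)" for v
    by (simp add: mem)
  have 2: "z \<in> C.Span K [1, s] \<longleftrightarrow> (\<exists>a\<in>K. \<exists>v\<in>C.line_extension K s {0}. z = a + v)" for z
    by (simp add: mem complex_field_simps)
  have "C.Span K [1, s] = L" unfolding L set_eq_iff 2 Bex_def 1 mem_Collect_eq by blast
  thus ?thesis using C.Span_finite_dimension[OF K, of "[1, s]"] by (simp add: complex_field_simps)
qed

text \<open>\<open>W\<close> is any set containing the span of \<open>f 0, \<dots>, f (i - 1)\<close> but not \<open>f i\<close>.\<close>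

lemma infinite_extI:
  assumes K: "is_field K"
    and f: "\<And>n :: nat. \<exists>f. \<forall>i<n. f i \<in> L \<and> (\<exists>W. f i \<notin> W \<and> 0 \<in> W \<and> (\<forall>k\<in>K. \<forall>w\<in>W. \<forall>j<i. k * f j + w \<in> W))"
  shows "\<not> finite_ext L K"
proof
  interpret C: Ring.field complex_field by (rule field_from_type_algebra)
  have mem: "z \<in> C.line_extension K u E \<longleftrightarrow> (\<exists>k\<in>K. \<exists>v\<in>E. z = k * u + v)" for z u E
    by (simp add: C.line_extension_mem_iff complex_field_simps)
  assume "finite_ext L K"
  then obtain n where n: "C.dimension n K L" by (auto simp: C.finite_dimension_def)
  obtain f where fL: "\<And>i. i < Suc n \<Longrightarrow> f i \<in> L" and W: "\<And>i. i < Suc n \<Longrightarrow>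
      \<exists>W. f i \<notin> W \<and> 0 \<in> W \<and> (\<forall>k\<in>K. \<forall>w\<in>W. \<forall>j<i. k * f j + w \<in> W)" using f[of "Suc n"] by blast
  define us where "us = (\<lambda>i. rev (map f [0..<i]))"
  have us_Suc: "us (Suc i) = f i # us i" for i by (simp add: us_def)
  have span: "C.Span K (us j) \<subseteq> W" if "0 \<in> W" "\<And>k w i. k \<in> K \<Longrightarrow> w \<in> W \<Longrightarrow> i < j \<Longrightarrow> k * f i + w \<in> W" for j W
    using that
  proof (induction j)
    case 0
    thus ?case by (simp add: us_def complex_field_simps)
  next
    case (Suc j)
    have "C.Span K (us j) \<subseteq> W" using Suc by auto
    moreover have "k * f j + w \<in> W" if "k \<in> K" "w \<in> W" for k w using Suc.prems that by blast
    moreover have "\<exists>k\<in>K. \<exists>w\<in>C.Span K (us j). z = k * f j + w" if "z \<in> C.Span K (us (Suc j))" for z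
      using that by (simp add: us_Suc mem)
    ultimately show ?case by (metis subsetD subsetI)
  qed
  have "C.independent K (us i)" if "i \<le> Suc n" for i
    using that
  proof (induction i)
    case 0
    show ?case by (simp add: us_def)
  next
    case (Suc i)
    obtain W where "f i \<notin> W" "0 \<in> W" "\<And>k w j. k \<in> K \<Longrightarrow> w \<in> W \<Longrightarrow> j < i \<Longrightarrow> k * f j + w \<in> W"
      using W[of i] Suc.prems by auto
    hence "f i \<notin> C.Span K (us i)" using span[of W i] by blast
    thus ?case using Suc unfolding us_Suc by (intro C.li_Cons) (auto simp: complex_field_simps)
  qed
  moreover have "set (us (Suc n)) \<subseteq> L" using fL by (auto simp: us_def simp del: upt_Suc)
  ultimately have "length (us (Suc n)) \<le> n" using C.independent_length_le_dimension[OF K n] by blast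
  thus False by (simp add: us_def)
qed

text \<open>For c = 2, \<open>degree_min_int_poly_root\<close> shows that x has degree at least 3^n,
  so its powers below n are independent. The set W for x^i consists of the values at x of rational
  polynomials with no term of degree i or more.\<close>

lemma infinite_ext_Rats:
  assumes L: "is_field L" "\<And>n. \<exists>x\<in>L. x ^ 3 ^ n = 2"
  shows "\<not> finite_ext L \<rat>"
proof (rule infinite_extI[OF is_field_Rats])
  fix n :: nat
  define N :: nat where "N = 3 ^ n"
  obtain x where x: "x \<in> L" "x ^ N = of_nat 2" using L(2)[of n] by (auto simp: N_def)
  have N: "n < N" unfolding N_def by (rule less_exp[THEN order.strict_trans2]) (auto intro: power_mono)
  have xQ: "x \<in> Qbar" using root_of_int_in_Qbar[of x N 2] x N by simp
  have deg: "N \<le> degree (min_int_poly x)"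
    using degree_min_int_poly_root[OF x(2)] N by (simp add: power_le_imp_le_exp)
  have "x ^ i \<in> L \<and> (\<exists>W. x ^ i \<notin> W \<and> 0 \<in> W \<and> (\<forall>k\<in>\<rat>. \<forall>w\<in>W. \<forall>j<i. k * x ^ j + w \<in> W))" if i: "i < n" for i
  proof (intro conjI exI ballI allI impI)
    let ?W = "{poly q x | q. q \<in> polys_over \<rat> \<and> (\<forall>j\<ge>i. coeff q j = 0)}"
    show "x ^ i \<in> L" using x L by auto
    have "poly 0 x = 0" by simp
    thus "0 \<in> ?W" using polys_over_0[of \<rat>] by (intro CollectI exI[of _ 0]) auto
    show "k * x ^ j + w \<in> ?W" if k: "k \<in> \<rat>" and w: "w \<in> ?W" and j: "j < i" for k w j
    proof -
      obtain q where "q \<in> polys_over \<rat>" "\<forall>j\<ge>i. coeff q j = 0" "w = poly q x" using w by blast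
      thus ?thesis using k j
        by (intro CollectI exI[of _ "Polynomial.monom k j + q"])
          (auto simp: poly_monom intro!: polys_over_add polys_over_monom)
    qed
    show "x ^ i \<notin> ?W"
    proof
      assume "x ^ i \<in> ?W"
      then obtain q where q: "q \<in> polys_over \<rat>" "\<forall>j\<ge>i. coeff q j = 0" "x ^ i = poly q x" by blast
      define r where "r = Polynomial.monom 1 i - q"
      have r: "r \<in> polys_over \<rat>" unfolding r_def using q by (intro polys_over_diff polys_over_monom) auto
      have rx: "poly r x = 0" using q by (simp add: r_def poly_monom)
      have "coeff r i = 1" using q by (simp add: r_def)
      hence r0: "r \<noteq> 0" by auto
      have dr: "degree r \<le> i" using q by (intro degree_le) (auto simp: r_def)
      obtain m g where mg: "m > 0" "Polynomial.smult (of_int m) r = of_int_poly g"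
        using clear_denominators[OF r] by blast
      have "poly (of_int_poly g) x = 0" using rx by (simp flip: mg(2))
      hence dvd: "min_int_poly x dvd g" by (rule min_int_poly_dvd[OF xQ])
      have "g \<noteq> 0" using mg r0 by auto
      moreover have "degree g = degree r" using arg_cong[OF mg(2), of degree] mg(1) by simp
      ultimately have "degree (min_int_poly x) \<le> i" using dvd_imp_degree_le[OF dvd] dr by simp
      thus False using deg N i by simp
    qed
  qed
  thus "\<exists>f. \<forall>i<n. f i \<in> L \<and> (\<exists>W. f i \<notin> W \<and> 0 \<in> W \<and> (\<forall>k\<in>\<rat>. \<forall>w\<in>W. \<forall>j<i. k * f j + w \<in> W))"
    by (intro exI[of _ "\<lambda>i. x ^ i"]) blast
qed

section \<open>The four situations\<close>

lemma of_real_sqrt_of_nat_power2 [simp]: "complex_of_real (sqrt (real n)) ^ 2 = of_nat n"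
  by (simp flip: of_real_power)

definition two_roots :: "complex set" where
  "two_roots = {x. \<exists>n. x ^ 3 ^ n = 2}"

definition prime_sqrts :: "complex set" where
  "prime_sqrts = (\<lambda>q. complex_of_real (sqrt (real q))) ` {q. prime q \<and> q \<ge> 5}"

lemma two_roots_tame:
  assumes "prime p" "p \<ge> 5"
  shows "two_roots \<subseteq> padic.tame_roots p"
proof
  fix x assume "x \<in> two_roots"
  then obtain n where n: "x ^ 3 ^ n = of_int 2" by (auto simp: two_roots_def)
  obtain V where "padic p V" using ex_padic[OF assms(1)] by blast
  then interpret padic p V .
  have "\<not> p dvd 3 ^ n"
  proof
    assume "p dvd 3 ^ n"
    hence "p dvd 3" using assms(1) prime_dvd_power by blast
    thus False using dvd_imp_le[of p 3] assms(2) by simp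
  qed
  moreover have "\<not> int p dvd 2" using zdvd_imp_le[of "int p" 2] assms(2) by auto
  ultimately show "x \<in> tame_roots" using n unfolding tame_roots_def by blast
qed

lemma sqrt_prime_tame:
  assumes "prime p" "p \<ge> 5" "prime q" "q \<noteq> p"
  shows "complex_of_real (sqrt (real q)) \<in> padic.tame_roots p"
proof -
  obtain V where "padic p V" using ex_padic[OF assms(1)] by blast
  then interpret padic p V .
  have "complex_of_real (sqrt (real q)) ^ 2 = of_int (int q)" by simp
  moreover have "\<not> p dvd 2" using dvd_imp_le[of p 2] assms(2) by auto
  moreover have "\<not> int p dvd int q" using primes_dvd_imp_eq[of p q] assms by auto
  ultimately show ?thesis unfolding tame_roots_def by blast
qed

text \<open>An unramified field containing all tame roots contains T but no such root of p. This
  serves both the independence of the square roots and the roots of 5 outside K.\<close>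

lemma no_root_of_prime_in_fgen:
  assumes p: "prime p" and T: "T \<subseteq> padic.tame_roots p" and x: "x ^ n = of_nat p" "n \<ge> 2"
  shows "x \<notin> fgen T"
proof
  assume xT: "x \<in> fgen T"
  obtain V where "padic p V" using ex_padic[OF p] by blast
  then interpret padic p V .
  obtain F where F: "unram F" "tame_roots \<subseteq> F" using ex_unram_tame_roots by blast
  have "fgen T \<subseteq> F" using T F by (intro fgen_least unram_is_field) auto
  thus False using unram_no_root[OF F(1) _ x(1)] xT x(2) by auto
qed

lemma two_roots_Qbar: "two_roots \<subseteq> Qbar"
  by (auto simp: two_roots_def intro!: root_of_int_in_Qbar[where u = 2])

lemma prime_sqrts_Qbar: "prime_sqrts \<subseteq> Qbar"
proof -
  have "complex_of_real (sqrt (real q)) \<in> Qbar" for q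
    using root_of_int_in_Qbar[of "complex_of_real (sqrt (real q))" 2 "int q"] by simp
  thus ?thesis by (auto simp: prime_sqrts_def)
qed

lemma ex_real_root: "\<exists>x::complex. x \<in> \<real> \<and> x \<noteq> 0 \<and> x ^ 3 ^ n = of_nat (Suc c)"
proof (intro exI conjI)
  show "(of_real (root (3 ^ n) (Suc c)) :: complex) \<in> \<real>" "(of_real (root (3 ^ n) (Suc c)) :: complex) \<noteq> 0"
    by simp_all
  show "(of_real (root (3 ^ n) (Suc c)) :: complex) ^ 3 ^ n = of_nat (Suc c)"
    unfolding of_real_power[symmetric] by (subst real_root_pow_pos2) auto
qed

text \<open>Only finitely many square roots are involved in x. When they are peeled off, the first
  one whose removal loses x is the root of a prime p at which all remaining generators are tame. The
  bound at p is at least ln 5 - ln 4, whatever the number of square roots.\<close>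

lemma bogomolov_ext_prime_sqrts: "bogomolov_ext (fgen (two_roots \<union> prime_sqrts)) (fgen two_roots)"
proof -
  have bound: "x \<in> fgen two_roots \<or> ln 5 - ln 4 \<le> 4 * weil_height x"
    if "finite U" "U \<subseteq> prime_sqrts" "x \<in> fgen (two_roots \<union> U)" for x U
    using that
  proof (induction U)
    case empty
    thus ?case by simp
  next
    case (insert s U)
    show ?case
    proof (cases "x \<in> fgen (two_roots \<union> U)")
      case True
      thus ?thesis using insert by auto
    next
      case False
      from insert.prems obtain p where p: "prime p" "p \<ge> 5" "s = complex_of_real (sqrt (real p))"
        by (auto simp: prime_sqrts_def)
      have "U \<subseteq> padic.tame_roots p"
      proof
        fix u assume u: "u \<in> U"
        with insert.prems obtain q where "prime q" "q \<ge> 5" "u = complex_of_real (sqrt (real q))"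
          by (auto simp: prime_sqrts_def)
        moreover from this u insert.hyps p have "q \<noteq> p" by auto
        ultimately show "u \<in> padic.tame_roots p" using sqrt_prime_tame p by auto
      qed
      hence "two_roots \<union> U \<subseteq> padic.tame_roots p" using two_roots_tame p by auto
      moreover have "x \<in> fgen (insert s (two_roots \<union> U))" using insert.prems by simp
      ultimately have "ln p - ln 4 \<le> 4 * weil_height x" using p False by (intro height_lower_bound) auto
      moreover have "ln 5 \<le> ln (real p)" using p by simp
      ultimately show ?thesis by linarith
    qed
  qed
  have "x \<in> fgen two_roots" if x: "x \<in> fgen (two_roots \<union> prime_sqrts)" "weil_height x < (ln 5 - ln 4) / 4" for x
  proof -
    obtain T where T: "finite T" "T \<subseteq> two_roots \<union> prime_sqrts" "x \<in> fgen T"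
      using fgen_finite_support[OF x(1)] by blast
    hence "x \<in> fgen (two_roots \<union> (T \<inter> prime_sqrts))"
      using fgen_mono[of T "two_roots \<union> (T \<inter> prime_sqrts)"] by auto
    with bound[of "T \<inter> prime_sqrts" x] T x(2) show ?thesis by auto
  qed
  moreover have "(ln 5 - ln 4) / 4 > (0 :: real)" by simp
  ultimately show ?thesis unfolding bogomolov_ext_def by blast
qed

text \<open>W for the i-th square root is the field generated by \<open>two_roots\<close> and the
  preceding square roots, all tame at the i-th prime. L is left arbitrary so that Qbar in situation
  (d) is covered too.\<close>

lemma infinite_ext_prime_sqrts:
  assumes "prime_sqrts \<subseteq> L"
  shows "\<not> finite_ext L (fgen two_roots)"
proof (rule infinite_extI)
  fix n :: nat
  have "infinite {q :: nat. prime q \<and> q \<ge> 5}"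
  proof
    assume "finite {q :: nat. prime q \<and> q \<ge> 5}"
    hence "finite ({q :: nat. prime q \<and> q \<ge> 5} \<union> {..<5})" by simp
    hence "finite {q :: nat. prime q}" by (rule finite_subset[rotated]) auto
    thus False using primes_infinite by simp
  qed
  then obtain r :: "nat \<Rightarrow> nat" where r: "strict_mono r" "\<And>i. prime (r i)" "\<And>i. r i \<ge> 5"
    using infinite_enumerate[of "{q :: nat. prime q \<and> q \<ge> 5}"] by auto
  define f where "f = (\<lambda>i. complex_of_real (sqrt (real (r i))))"
  have "f i \<in> L \<and> (\<exists>W. f i \<notin> W \<and> 0 \<in> W \<and> (\<forall>k\<in>fgen two_roots. \<forall>w\<in>W. \<forall>j<i. k * f j + w \<in> W))" for i
  proof (intro conjI exI ballI allI impI)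
    let ?T = "two_roots \<union> f ` {..<i}"
    show "f i \<in> L" using assms r by (auto simp: f_def prime_sqrts_def)
    show "0 \<in> fgen ?T" by auto
    have "r j \<noteq> r i" if "j < i" for j using that r(1) by (metis strict_mono_eq less_irrefl)
    hence "?T \<subseteq> padic.tame_roots (r i)"
      using r two_roots_tame sqrt_prime_tame by (auto simp: f_def)
    thus "f i \<notin> fgen ?T" using r by (intro no_root_of_prime_in_fgen[of "r i" _ _ 2]) (auto simp: f_def)
    fix k w j assume *: "k \<in> fgen two_roots" "w \<in> fgen ?T" "j < i"
    have "k \<in> fgen ?T" using * fgen_mono[of two_roots ?T] by auto
    moreover have "f j \<in> fgen ?T" using * by (intro fgen.gen) auto
    ultimately show "k * f j + w \<in> fgen ?T" using * is_field_fgen[of ?T] by blast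
  qed
  thus "\<exists>f. \<forall>i<n. f i \<in> L \<and> (\<exists>W. f i \<notin> W \<and> 0 \<in> W \<and> (\<forall>k\<in>fgen two_roots. \<forall>w\<in>W. \<forall>j<i. k * f j + w \<in> W))"
    by blast
qed auto

theorem theorem1p3:
  shows
   "(\<exists>K L. is_field K \<and> is_field L \<and> K \<subseteq> L \<and> L \<subseteq> Qbar \<and>
       \<not> finite_ext K \<rat> \<and> \<not> bogomolov K \<and>
       finite_ext L K \<and> bogomolov_ext L K) \<and>
    (\<exists>K L. is_field K \<and> is_field L \<and> K \<subseteq> L \<and> L \<subseteq> Qbar \<and>
       \<not> finite_ext K \<rat> \<and> \<not> bogomolov K \<and>
       finite_ext L K \<and> \<not> bogomolov_ext L K) \<and>
    (\<exists>K L. is_field K \<and> is_field L \<and> K \<subseteq> L \<and> L \<subseteq> Qbar \<and>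
       \<not> finite_ext K \<rat> \<and> \<not> bogomolov K \<and>
       \<not> finite_ext L K \<and> bogomolov_ext L K) \<and>
    (\<exists>K L. is_field K \<and> is_field L \<and> K \<subseteq> L \<and> L \<subseteq> Qbar \<and>
       \<not> finite_ext K \<rat> \<and> \<not> bogomolov K \<and>
       \<not> finite_ext L K \<and> \<not> bogomolov_ext L K)"
proof (intro conjI)
  let ?K = "fgen two_roots"
  have K_roots: "\<exists>x\<in>?K. x ^ 3 ^ n = 2" for n
    using ex_real_root[of n 1] by (auto simp: two_roots_def intro: fgen.gen)
  have KQ: "?K \<subseteq> Qbar" by (rule fgen_in_Qbar[OF two_roots_Qbar])
  have K: "is_field ?K" "\<not> finite_ext ?K \<rat>" "\<not> bogomolov ?K"
    using infinite_ext_Rats[OF _ K_roots] not_bogomolovI[OF K_roots] by auto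

  show "\<exists>K L. is_field K \<and> is_field L \<and> K \<subseteq> L \<and> L \<subseteq> Qbar \<and>
       \<not> finite_ext K \<rat> \<and> \<not> bogomolov K \<and> finite_ext L K \<and> bogomolov_ext L K"
  proof (intro exI conjI)
    let ?L = "fgen (insert (complex_of_real (sqrt 5)) two_roots)"
    have "complex_of_real (sqrt 5) \<in> prime_sqrts" unfolding prime_sqrts_def by (rule image_eqI[of _ _ 5]) simp_all
    hence *: "?L \<subseteq> fgen (two_roots \<union> prime_sqrts)" by (intro fgen_mono) auto
    show "?K \<subseteq> ?L" by (intro fgen_mono) auto
    show "?L \<subseteq> Qbar"
      using * fgen_in_Qbar[of "two_roots \<union> prime_sqrts"] two_roots_Qbar prime_sqrts_Qbar by auto
    show "finite_ext ?L ?K" 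
      using ring_set_of_nat[of ?K 5] of_real_sqrt_of_nat_power2[of 5]
      by (intro finite_ext_sqrt[OF K(1) fgen_insert_sqrt]) simp_all
    show "bogomolov_ext ?L ?K" using bogomolov_ext_prime_sqrts * unfolding bogomolov_ext_def by blast
  qed (use K in auto)

  show "\<exists>K L. is_field K \<and> is_field L \<and> K \<subseteq> L \<and> L \<subseteq> Qbar \<and>
       \<not> finite_ext K \<rat> \<and> \<not> bogomolov K \<and> finite_ext L K \<and> \<not> bogomolov_ext L K"
  proof (intro exI conjI)
    let ?R = "Qbar \<inter> \<real>"
    have x: "\<exists>x\<in>?R. x ^ 3 ^ n = 2" for n
      using ex_real_root[of n 1] root_of_int_in_Qbar[of _ "3 ^ n" 2] by auto
    show R: "is_field ?R" using is_field_Qbar by (auto simp: is_field_iff ring_set_def)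
    show "\<not> finite_ext ?R \<rat>" by (rule infinite_ext_Rats[OF R x])
    show "\<not> bogomolov ?R" by (rule not_bogomolovI[OF x])
    have i: "\<i> \<in> Qbar" by (simp add: Qbar_def)
    show "finite_ext Qbar ?R"
    proof (rule finite_ext_sqrt[OF R, where s = \<i>], intro equalityI subsetI)
      fix z assume z: "z \<in> Qbar"
      have "cnj z \<in> Qbar"
      proof -
        obtain p where p: "p \<in> polys_over \<rat>" "p \<noteq> 0" "poly p z = 0" using z by (rule QbarE)
        have "coeff p n \<in> \<real>" for n
          using polys_over_coeff[OF p(1), of n] by (auto elim!: Rats_cases')
        thus ?thesis using p poly_cnj_real[of p "cnj z"] by (intro QbarI[of p]) auto
      qed
      hence "(z + cnj z) / of_nat 2 \<in> Qbar" "(z - cnj z) / (of_nat 2 * \<i>) \<in> Qbar"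
        using z i is_field_Qbar by blast+
      moreover have "(z + cnj z) / of_nat 2 = of_real (Re z)" "(z - cnj z) / (of_nat 2 * \<i>) = of_real (Im z)"
        by (auto simp: complex_eq_iff)
      ultimately have "of_real (Re z) \<in> ?R" "of_real (Im z) \<in> ?R" by auto
      moreover have "z = of_real (Re z) + of_real (Im z) * \<i>" by (simp add: complex_eq_iff)
      ultimately show "z \<in> {a + b * \<i> | a b. a \<in> ?R \<and> b \<in> ?R}" by blast
    next
      fix z assume "z \<in> {a + b * \<i> | a b. a \<in> ?R \<and> b \<in> ?R}"
      thus "z \<in> Qbar" using i is_field_ring_set[OF is_field_Qbar] by blast
    qed
    show "\<not> bogomolov_ext Qbar ?R"
    \<comment> \<open>From x^(3^n) = 2 follows (\<i> x)^(4 3^n) = 2^4 = 16; the factor 4 in the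
      exponent removes \<i>.\<close>
    proof (rule not_bogomolov_extI[where m = 4 and c = 16 and ?n0.0 = 0])
      fix n :: nat
      obtain x :: complex where x: "x \<in> \<real>" "x \<noteq> 0" "x ^ 3 ^ n = of_nat (Suc 1)" using ex_real_root[of n 1] by blast
      have "\<i> * x \<in> Qbar"
        using x(3) i is_field_Qbar root_of_int_in_Qbar[of x "3 ^ n" 2] by auto
      moreover have "\<i> * x \<notin> \<real>" using x by (auto simp: complex_is_Real_iff complex_eq_iff)
      moreover have "(\<i> * x) ^ (3 ^ n * 4) = (\<i> ^ 4) ^ 3 ^ n * (x ^ 3 ^ n) ^ 4"
        by (simp only: power_mult_distrib power_mult[symmetric] mult.commute)
      hence "(\<i> * x) ^ (3 ^ n * 4) = of_nat 16" using x(3) by simp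
      ultimately show "\<exists>x. x \<in> Qbar - ?R \<and> x ^ (3 ^ n * 4) = of_nat 16" by blast
    qed auto
  qed (use is_field_Qbar in auto)

  show "\<exists>K L. is_field K \<and> is_field L \<and> K \<subseteq> L \<and> L \<subseteq> Qbar \<and>
       \<not> finite_ext K \<rat> \<and> \<not> bogomolov K \<and> \<not> finite_ext L K \<and> bogomolov_ext L K"
  proof (intro exI conjI)
    let ?L = "fgen (two_roots \<union> prime_sqrts)"
    show "?K \<subseteq> ?L" by (intro fgen_mono) auto
    show "?L \<subseteq> Qbar" using two_roots_Qbar prime_sqrts_Qbar by (intro fgen_in_Qbar) auto
    show "\<not> finite_ext ?L ?K" by (rule infinite_ext_prime_sqrts) (auto intro: fgen.gen)
    show "bogomolov_ext ?L ?K" by (rule bogomolov_ext_prime_sqrts)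
  qed (use K in auto)

  show "\<exists>K L. is_field K \<and> is_field L \<and> K \<subseteq> L \<and> L \<subseteq> Qbar \<and>
       \<not> finite_ext K \<rat> \<and> \<not> bogomolov K \<and> \<not> finite_ext L K \<and> \<not> bogomolov_ext L K"
  proof (intro exI conjI)
    show "\<not> finite_ext Qbar ?K" by (rule infinite_ext_prime_sqrts[OF prime_sqrts_Qbar])
    show "\<not> bogomolov_ext Qbar ?K"
    \<comment> \<open>The start at n = 1 matters: for n = 0 the root is 5 itself, an element of
      K.\<close>
    proof (rule not_bogomolov_extI[where m = 1 and c = 5 and ?n0.0 = 1])
      fix n :: nat assume n: "n \<ge> 1"
      obtain x :: complex where x: "x ^ 3 ^ n = of_nat (Suc 4)" using ex_real_root[of n 4] by blast
      have "x \<in> Qbar" using x root_of_int_in_Qbar[of x "3 ^ n" 5] by auto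
      moreover have "(3 :: nat) ^ n \<ge> 2" using power_increasing[OF n, of "3 :: nat"] by simp
      hence "x \<notin> ?K" using two_roots_tame[of 5] x by (intro no_root_of_prime_in_fgen[of 5]) auto
      ultimately show "\<exists>x. x \<in> Qbar - ?K \<and> x ^ (3 ^ n * 1) = of_nat 5" using x by auto
    qed auto
  qed (use K KQ is_field_Qbar in auto)
qed

end
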